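(* Let $\mathcal{C}>0$, $\beta\in(0,1]$, and let $d\ge3$ be an integer with $d\ge\max\{9,\lfloor 2+4/\beta\rfloor+1\}$. Let $X$ be a $p_n$-ERW in direction $\ell\in\mathbb{S}^{d-1}$ on $\mathbb{Z}^d$ with $p_n=\mathcal{C}n^{-\beta}\wedge1$. Then $$\liminf_{n\to\infty}\frac{|\mathcal{R}_n^X|}{n}\ge\pi_d\quad\text{almost surely.}$$
   Context: Definition of the $p_n$-ERW in direction $\ell$ on $\mathbb{Z}^d$. Let $d\ge 2$, let $\ell\in\mathbb{S}^{d-1}$ (the unit sphere of $\mathbb{R}^d$), let $\|\cdot\|$ be the Euclidean norm, and let $\{p_n\}_{n\ge1}\subset(0,1]$. Let $\{\xi_i\}_{i\ge1}$ and $\{\gamma_i\}_{i\ge1}$ be sequences of $\mathbb{Z}^d$-valued random vectors on a probability space $(\Omega,\mathcal{F},\mathbb{P})$, adapted to a filtration $\{\mathcal{F}_n\}_{n\ge0}$ (with $\mathcal{F}_0$ containing all null sets), such that: (i) there is a constant $K>0$ with $\sup_{n}\|\xi_n\|\le K$ and $\sup_n\|\gamma_n\|\le K$ on every realization; (ii) there is a constant $\lambda>0$ such that for all $n\ge1$, $\mathbb{E}[\xi_n\mid\mathcal{F}_{n-1}]=0$ and $\mathbb{E}[\gamma_n\cdot\ell\mid\mathcal{F}_{n-1}]\ge\lambda$; (iii) $\{\xi_i\}$ is i.i.d. with zero mean vector and finite covariance matrix, and $\mathbb{P}[\xi_i\cdot\ell'=0]<1$ for all $\ell'\in\mathbb{S}^{d-1}$;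 (iv) $\{\gamma_i\}$ is i.i.d., and the sequences $\{\xi_i\}$ and $\{\gamma_i\}$ are independent of each other. Let $\{U_i\}_{i\ge1}$ be i.i.d. uniform on $[0,1]$, independent of $(\{\xi_i\},\{\gamma_i\})$. Set $X_0=0$, $E_0=\emptyset$, and for $n\ge1$ let $E_n=\{\exists k<n:\ X_k=X_n\}$. The process $X=\{X_n\}_{n\ge0}$ is defined by $$X_n=\sum_{i=1}^n\Big(\mathbf{1}_{E_{i-1}}\xi_i+\mathbf{1}_{E_{i-1}^c\cap\{U_i>p_i\}}\xi_i+\mathbf{1}_{E_{i-1}^c\cap\{U_i\le p_i\}}\gamma_i\Big),\quad n\ge1.$$ The range is $\mathcal{R}_n^X=\{X_0,X_1,\dots,X_n\}\subset\mathbb{Z}^d$. The constant $\pi_d$ is the probability that the random walk $Y_n=\sum_{i=1}^n\xi_i$, $Y_0=0$, never returns to the origin. $a\wedge b=\min(a,b)$. *)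

theory Defs
  imports "HOL-Probability.Probability"
begin

text \<open>
  Points of the lattice have type \<open>int ^ 'd\<close>, so \<open>d = CARD('d)\<close>; the lattice carries the discrete
  sigma-algebra \<open>count_space UNIV\<close>.  All sequences of random variables are indexed from 1: their
  value at index 0 is never constrained or used.
\<close>

definition real_vec :: "int ^ 'd \<Rightarrow> real ^ 'd" where
  "real_vec x = (\<chi> j. real_of_int (x $ j))"

definition revisit :: "(nat \<Rightarrow> 'a \<Rightarrow> 'b) \<Rightarrow> nat \<Rightarrow> 'a set" where
  "revisit X n = {\<omega>. \<exists>k<n. X k \<omega> = X n \<omega>}"

definition walk_range :: "(nat \<Rightarrow> 'a \<Rightarrow> 'b) \<Rightarrow> nat \<Rightarrow> 'a \<Rightarrow> 'b set" where
  "walk_range X n \<omega> = (\<lambda>k. X k \<omega>) ` {0..n}"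

definition no_return_prob :: "'a measure \<Rightarrow> (nat \<Rightarrow> 'a \<Rightarrow> int ^ 'd) \<Rightarrow> real" where
  "no_return_prob M \<xi> = measure M {\<omega> \<in> space M. \<forall>n\<ge>1. (\<Sum>i=1..n. \<xi> i \<omega>) \<noteq> 0}"

abbreviation (input) seq_from_1 :: "(nat \<Rightarrow> 'a \<Rightarrow> 'b) \<Rightarrow> 'a \<Rightarrow> nat \<Rightarrow> 'b" where
  "seq_from_1 Z \<equiv> \<lambda>\<omega>. \<lambda>i\<in>{1..}. Z i \<omega>"

abbreviation (input) lattice_seq :: "(nat \<Rightarrow> int ^ 'd) measure" where
  "lattice_seq \<equiv> \<Pi>\<^sub>M i\<in>{1..}. count_space UNIV"

abbreviation (input) real_seq :: "(nat \<Rightarrow> real) measure" where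
  "real_seq \<equiv> \<Pi>\<^sub>M i\<in>{1..}. borel"

text \<open>
  The equation \<open>walk\<close> determines \<open>X\<close> uniquely on \<open>space M\<close>, because \<open>revisit X (i - 1)\<close> only depends
  on \<open>X 0, \<dots>, X (i - 1)\<close>; for \<open>n = 0\<close> it reads \<open>X 0 = 0\<close>.

  The condition \<open>U_indep\<close> is spelled out with \<open>indep_set\<close> since \<open>indep_var\<close> requires both variables
  to take values in the same type.

  The condition \<open>\<xi>_cov\<close> is finiteness of the covariance matrix, the mean being zero.
\<close>

locale pn_ERW = prob_space M + filtration "space M" F
  for M :: "'a measure" and F :: "nat \<Rightarrow> 'a measure" +
  fixes \<xi> \<gamma> :: "nat \<Rightarrow> 'a \<Rightarrow> int ^ 'd"
    and U :: "nat \<Rightarrow> 'a \<Rightarrow> real"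
    and p :: "nat \<Rightarrow> real"
    and l :: "real ^ 'd"
    and X :: "nat \<Rightarrow> 'a \<Rightarrow> int ^ 'd"
  assumes dim: "CARD('d) \<ge> 2"
    and dir: "norm l = 1"
    and p_range: "\<And>n. n \<ge> 1 \<Longrightarrow> 0 < p n \<and> p n \<le> 1"
    and F_sub: "\<And>n. subalgebra M (F n)"
    and F_null: "null_sets M \<subseteq> sets (F 0)"
    and \<xi>_adapted: "\<And>n. n \<ge> 1 \<Longrightarrow> \<xi> n \<in> F n \<rightarrow>\<^sub>M count_space UNIV"
    and \<gamma>_adapted: "\<And>n. n \<ge> 1 \<Longrightarrow> \<gamma> n \<in> F n \<rightarrow>\<^sub>M count_space UNIV"
    and bounded: "\<exists>K>0. \<forall>n\<ge>1. \<forall>\<omega>\<in>space M. norm (real_vec (\<xi> n \<omega>)) \<le> K \<and> norm (real_vec (\<gamma> n \<omega>)) \<le> K"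
    and \<xi>_cond_mean: "\<And>n j. n \<ge> 1 \<Longrightarrow>
          AE \<omega> in M. real_cond_exp M (F (n - 1)) (\<lambda>\<omega>. real_vec (\<xi> n \<omega>) $ j) \<omega> = 0"
    and \<gamma>_drift: "\<exists>c>0. \<forall>n\<ge>1.
          AE \<omega> in M. real_cond_exp M (F (n - 1)) (\<lambda>\<omega>. real_vec (\<gamma> n \<omega>) \<bullet> l) \<omega> \<ge> c"
    and \<xi>_indep: "indep_vars (\<lambda>_. count_space UNIV) \<xi> {1..}"
    and \<xi>_ident: "\<And>i. i \<ge> 1 \<Longrightarrow> distr M (count_space UNIV) (\<xi> i) = distr M (count_space UNIV) (\<xi> 1)"
    and \<xi>_mean: "\<And>i. i \<ge> 1 \<Longrightarrow> expectation (\<lambda>\<omega>. real_vec (\<xi> i \<omega>)) = 0"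
    and \<xi>_cov: "\<And>i j k. i \<ge> 1 \<Longrightarrow> integrable M (\<lambda>\<omega>. real_vec (\<xi> i \<omega>) $ j * real_vec (\<xi> i \<omega>) $ k)"
    and \<xi>_nondegenerate: "\<And>i u. i \<ge> 1 \<Longrightarrow> norm u = 1 \<Longrightarrow> \<P>(\<omega> in M. real_vec (\<xi> i \<omega>) \<bullet> u = 0) < 1"
    and \<gamma>_indep: "indep_vars (\<lambda>_. count_space UNIV) \<gamma> {1..}"
    and \<gamma>_ident: "\<And>i. i \<ge> 1 \<Longrightarrow> distr M (count_space UNIV) (\<gamma> i) = distr M (count_space UNIV) (\<gamma> 1)"
    and \<xi>_\<gamma>_indep: "indep_var lattice_seq (seq_from_1 \<xi>) lattice_seq (seq_from_1 \<gamma>)"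
    and U_iid: "indep_vars (\<lambda>_. borel) U {1..}"
    and U_uniform: "\<And>i. i \<ge> 1 \<Longrightarrow> distr M borel (U i) = uniform_measure lborel {0..1}"
    and U_indep: "indep_set
          {(\<lambda>\<omega>. (seq_from_1 \<xi> \<omega>, seq_from_1 \<gamma> \<omega>)) -` A \<inter> space M | A. A \<in> sets (lattice_seq \<Otimes>\<^sub>M lattice_seq)}
          {seq_from_1 U -` B \<inter> space M | B. B \<in> sets real_seq}"
    and walk: "\<And>n \<omega>. \<omega> \<in> space M \<Longrightarrow> X n \<omega> =
          (\<Sum>i=1..n. indicator (revisit X (i - 1)) \<omega> *s \<xi> i \<omega>
                   + indicator (- revisit X (i - 1) \<inter> {\<omega>. U i \<omega> > p i}) \<omega> *s \<xi> i \<omega>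
                   + indicator (- revisit X (i - 1) \<inter> {\<omega>. U i \<omega> \<le> p i}) \<omega> *s \<gamma> i \<omega>)"

end

theory Submission
  imports Defs "HOL-Real_Asymp.Real_Asymp"
begin

text \<open>
  The range grows at least as fast as the number of times at which the walk enters a site that it
  has never visited.  Call time \<open>i\<close> a coin time if \<open>U i \<le> p i\<close>; the excited steps \<open>\<gamma> i\<close> are
  only taken at coin times.  Between coin times \<open>X\<close> moves by the increments \<open>\<xi> i\<close>, whatever it has
  visited before.  For each time \<open>t\<close> look back over a window of length \<open>h t = \<lfloor>t powr (\<beta> / 2)\<rfloor>\<close>,
  starting at \<open>s = t - h t\<close>.  The site \<open>X t\<close> is new as soon as three things hold:
  there is no coin time in the window; the sum of the increments \<open>\<xi> i\<close> over the window does not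
  carry \<open>X s\<close> to one of the sites \<open>X 0, \<dots>, X s\<close>; and no nonempty final segment of these
  increments sums to zero.

  The first two conditions fail only on a set of times of density zero.  A coin time in the window
  has probability of order \<open>h t * t powr (- \<beta>) = t powr (- \<beta> / 2)\<close>.  For the second condition the
  history up to time \<open>s\<close> determines the old sites and is independent of the increments in the window: each of the \<open>s + 1\<close> old sites is hit with probability at most
  \<open>c * h t powr (- d / 2)\<close> (\<open>heat_kernel_bound\<close>, \<open>hit_past_prob\<close>).  Both
  failure probabilities, divided by \<open>t\<close>, have a finite sum because \<open>\<beta> * d > 4\<close>, and
  this gives density zero almost surely (\<open>AE_density_zero\<close>).

  The third condition only concerns the walk with increments \<open>\<xi>\<close>.  Read backwards in time it says
  that this walk does not return to its starting point during the first \<open>h t\<close> steps, so its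
  probability is at least the escape probability (\<open>no_return_window_prob\<close>).  It depends on the
  increments in the window only, so two such events are independent once their times are a window
  apart, and since \<open>h t\<close> is at most the square root of \<open>t\<close>, a variance estimate along the fourth
  powers shows that they have lower density at least the escape probability
  (\<open>AE_density_local_dependence\<close>).

  The heat kernel bound is obtained without Fourier analysis.  If the step law charges both \<open>a\<close> and
  \<open>b\<close>, a positive fraction of the steps may be regarded as fair choices between \<open>a\<close> and \<open>b\<close>;
  their binomial spreading along the direction \<open>b - a\<close> gains a factor \<open>m powr (- 1 / 2)\<close> over \<open>m\<close>
  steps.  The support of a centred law that no hyperplane through \<open>0\<close> carries provides \<open>d\<close> linearly independent
  directions, and spending a \<open>d\<close>-th of the time on each yields the exponent \<open>d / 2\<close>.
\<close>

section \<open>Convolutions on the integer lattice\<close>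

definition conv :: "(int ^ 'd \<Rightarrow> ennreal) \<Rightarrow> (int ^ 'd \<Rightarrow> ennreal) \<Rightarrow> int ^ 'd \<Rightarrow> ennreal" where
  "conv w f z = (\<integral>\<^sup>+ b. w b * f (z - b) \<partial>count_space UNIV)"

text \<open>
  Once the walk has been spread out along the direction \<open>v\<close>, only the total of \<open>f\<close> on a line matters,
  no longer how it is distributed there.
\<close>

definition line_sum :: "int ^ 'd \<Rightarrow> (int ^ 'd \<Rightarrow> ennreal) \<Rightarrow> int ^ 'd \<Rightarrow> ennreal" where
  "line_sum v f z = (\<integral>\<^sup>+ j. f (z + j *s v) \<partial>count_space UNIV)"

text \<open>
  Convolution with the law of a fair choice between \<open>a\<close> and \<open>b\<close>.
\<close>

definition pair_avg :: "int ^ 'd \<Rightarrow> int ^ 'd \<Rightarrow> (int ^ 'd \<Rightarrow> ennreal) \<Rightarrow> int ^ 'd \<Rightarrow> ennreal" where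
  "pair_avg a b f z = ennreal (1 / 2) * (f (z - a) + f (z - b))"

lemma line_sum_conv:
  fixes w :: "int ^ 'd \<Rightarrow> ennreal"
  shows "line_sum v (conv w f) = conv w (line_sum v f)"
proof
  fix z
  have "line_sum v (conv w f) z =
      (\<integral>\<^sup>+ b. \<integral>\<^sup>+ j. w b * f (z + j *s v - b) \<partial>count_space UNIV \<partial>count_space UNIV)"
    unfolding line_sum_def conv_def by (rule nn_integral_count_space_nn_integral) auto
  also have "\<dots> = conv w (line_sum v f) z"
    unfolding line_sum_def conv_def by (simp add: nn_integral_cmult algebra_simps)
  finally show "line_sum v (conv w f) z = conv w (line_sum v f) z" .
qed

lemma line_sum_funpow_conv: "line_sum v ((conv w ^^ m) f) = (conv w ^^ m) (line_sum v f)"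
  by (induction m) (simp_all add: line_sum_conv)

lemma conv_add: "conv w (\<lambda>z. f z + g z) = (\<lambda>z. conv w f z + conv w g z)"
  by (simp add: fun_eq_iff conv_def distrib_left nn_integral_add)

lemma conv_cmult: "conv w (\<lambda>z. c * f z) = (\<lambda>z. c * conv w f z)"
  by (simp add: fun_eq_iff conv_def nn_integral_cmult[symmetric] mult.left_commute)

lemma funpow_conv_add: "(conv w ^^ m) (\<lambda>z. f z + g z) = (\<lambda>z. (conv w ^^ m) f z + (conv w ^^ m) g z)"
  by (induction m) (simp_all add: conv_add)

lemma funpow_conv_cmult: "(conv w ^^ m) (\<lambda>z. c * f z) = (\<lambda>z. c * (conv w ^^ m) f z)"
  by (induction m) (simp_all add: conv_cmult)

lemma conv_le:
  assumes "\<And>z. f z \<le> B"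
  shows "conv w f z \<le> (\<integral>\<^sup>+ b. w b \<partial>count_space UNIV) * B"
proof -
  have "conv w f z \<le> (\<integral>\<^sup>+ b. w b * B \<partial>count_space UNIV)"
    unfolding conv_def by (intro nn_integral_mono mult_left_mono assms) auto
  then show ?thesis by (simp add: nn_integral_multc)
qed

lemma funpow_conv_le:
  assumes "(\<integral>\<^sup>+ b. w b \<partial>count_space UNIV) = 1" and "\<And>z. f z \<le> B"
  shows "(conv w ^^ m) f z \<le> B"
proof (induction m arbitrary: z)
  case (Suc m)
  show ?case using conv_le[of "(conv w ^^ m) f" B w z] Suc assms(1) by simp
qed (simp add: assms(2))

lemma pair_avg_conv:
  fixes a b :: "int ^ 'd"
  shows "pair_avg a b (conv w f) = conv w (pair_avg a b f)"
proof -
  have P: "pair_avg a b f = (\<lambda>z. ennreal (1 / 2) * (f (z - a) + f (z - b)))" for f :: "int ^ 'd \<Rightarrow> ennreal"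
    by (simp add: fun_eq_iff pair_avg_def)
  have shift: "conv w f (z - c) = conv w (\<lambda>z. f (z - c)) z" for c z
    by (simp add: conv_def algebra_simps)
  show ?thesis unfolding P conv_cmult conv_add shift ..
qed

lemma funpow_pair_avg_conv: "(pair_avg a b ^^ k) (conv w f) = conv w ((pair_avg a b ^^ k) f)"
  by (induction k) (simp_all add: pair_avg_conv)

text \<open>
  The binomial weights are bounded by their central value; this is where the factor
  \<open>k powr (- 1 / 2)\<close> of the heat kernel comes from.
\<close>

lemma central_binomial_upper: "(2 * m choose m) / 4 ^ m \<le> 1 / sqrt (2 * real m + 1)"
proof (induction m)
  case (Suc m)
  have rec: "real (Suc m) * real (2 * Suc m choose Suc m) = 2 * (2 * real m + 1) * real (2 * m choose m)"
  proof -
    have "Suc m * (Suc (Suc (2 * m)) choose Suc m) = Suc (Suc (2 * m)) * (Suc (2 * m) choose m)"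
      by (rule Suc_times_binomial)
    moreover have "Suc m * (Suc (2 * m) choose m) = Suc (2 * m) * (2 * m choose m)"
      using Suc_times_binomial_add[of m m] binomial_absorb_comp[of "Suc (2*m)" m]
      by (simp add: mult.commute)
    ultimately have "Suc m * (Suc m * (2 * Suc m choose Suc m)) = Suc m * (2 * (2 * m + 1) * (2 * m choose m))"
      by (simp add: algebra_simps)
    then have "Suc m * (2 * Suc m choose Suc m) = 2 * (2 * m + 1) * (2 * m choose m)"
      by (metis mult_cancel1 nat.distinct(1))
    then have "real (Suc m * (2 * Suc m choose Suc m)) = real (2 * (2 * m + 1) * (2 * m choose m))"
      by presburger
    then show ?thesis by (simp only: of_nat_mult) simp
  qed
  have "(2 * Suc m choose Suc m) / 4 ^ Suc m = (2 * real m + 1) / (2 * real m + 2) * ((2 * m choose m) / 4 ^ m)"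
  proof -
    have "C / (4 * Q) = (2 * real m + 1) / (2 * real m + 2) * (B / Q)"
      if "real (Suc m) * C = 2 * (2 * real m + 1) * B" and "Q > 0" for B C Q :: real
      using that by (simp add: divide_simps) (simp add: algebra_simps)
    from this[OF rec, of "4 ^ m"] show ?thesis unfolding power_Suc by simp
  qed
  also have "\<dots> \<le> (2 * real m + 1) / (2 * real m + 2) * (1 / sqrt (2 * real m + 1))"
    by (intro mult_left_mono Suc) auto
  also have "\<dots> \<le> 1 / sqrt (2 * real (Suc m) + 1)"
  proof -
    have "sqrt ((2 * real m + 1) * (2 * real m + 3)) \<le> 2 * real m + 2"
      by (rule real_le_lsqrt) (simp_all add: power2_eq_square algebra_simps)
    then have "sqrt (2 * real m + 1) * sqrt (2 * real m + 3) \<le> 2 * real m + 2"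
      by (simp only: real_sqrt_mult)
    then have "sqrt (2 * real m + 1) / (2 * real m + 2) \<le> 1 / sqrt (2 * real m + 3)"
      by (simp add: pos_divide_le_eq pos_le_divide_eq)
    moreover have "(2 * real m + 1) / (2 * real m + 2) * (1 / sqrt (2 * real m + 1)) = sqrt (2 * real m + 1) / (2 * real m + 2)"
    proof -
      have "(2 * real m + 1) / sqrt (2 * real m + 1) = sqrt (2 * real m + 1)"
        by (rule real_div_sqrt) simp
      then show ?thesis by (metis mult.right_neutral times_divide_eq_left times_divide_eq_right)
    qed
    ultimately show ?thesis by (simp add: algebra_simps)
  qed
  finally show ?case .
qed simp

lemma binomial_le_sqrt: "(k choose j) / 2 ^ k \<le> 1 / sqrt (real k + 1)"
proof -
  have "real (k choose j) \<le> real (k choose (k div 2))"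
    using binomial_maximum[of k j] by simp
  then have "(k choose j) / 2 ^ k \<le> (k choose (k div 2)) / 2 ^ k" by (simp add: divide_right_mono)
  also have "\<dots> \<le> 1 / sqrt (real k + 1)"
  proof (cases "even k")
    case True
    then obtain m where "k = 2 * m" by auto
    then show ?thesis using central_binomial_upper[of m] by (simp add: power_mult)
  next
    case False
    then obtain m where k: "k = 2 * m + 1" by (auto elim: oddE)
    have "(2 * Suc m choose Suc m) = (Suc (2 * m) choose m) + (Suc (2 * m) choose Suc m)" by simp
    also have "(Suc (2 * m) choose Suc m) = (Suc (2 * m) choose m)"
      using binomial_symmetric[of "Suc m" "Suc (2 * m)"] by simp
    finally have "real (2 * Suc m choose Suc m) = 2 * real (k choose (k div 2))" using k by simp
    then have "(k choose (k div 2)) / 2 ^ k = (2 * Suc m choose Suc m) / 4 ^ Suc m"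
      using k by (simp add: power_mult)
    also have "\<dots> \<le> 1 / sqrt (2 * real (Suc m) + 1)" by (rule central_binomial_upper)
    also have "\<dots> \<le> 1 / sqrt (real k + 1)" using k by (simp add: divide_simps)
    finally show ?thesis .
  qed
  finally show ?thesis .
qed

lemma funpow_pair_avg:
  "(pair_avg a b ^^ k) f z =
     (\<Sum>j\<le>k. ennreal ((k choose j) / 2 ^ k) * f (z - int (k - j) *s a - int j *s b))"
proof (induction k arbitrary: z)
  case (Suc k)
  let ?g = "\<lambda>j. f (z - int (Suc k - j) *s a - int j *s b)"
  have A: "(\<Sum>j\<le>k. ennreal ((k choose j) / 2 ^ k) * f (z - a - int (k - j) *s a - int j *s b))
     = (\<Sum>j\<le>Suc k. ennreal ((k choose j) / 2 ^ k) * ?g j)"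
  proof -
    have "z - a - int (k - j) *s a = z - int (Suc k - j) *s a" if "j \<le> k" for j
      using that by (simp add: vec_eq_iff algebra_simps Suc_diff_le)
    then have "(\<Sum>j\<le>k. ennreal ((k choose j) / 2 ^ k) * f (z - a - int (k - j) *s a - int j *s b))
        = (\<Sum>j\<le>k. ennreal ((k choose j) / 2 ^ k) * ?g j)"
      by (intro sum.cong refl arg_cong2[where f = "(*)"] arg_cong[where f = f]) simp
    then show ?thesis unfolding sum.atMost_Suc by simp
  qed
  have B: "(\<Sum>j\<le>k. ennreal ((k choose j) / 2 ^ k) * f (z - b - int (k - j) *s a - int j *s b))
     = (\<Sum>j\<le>Suc k. ennreal ((if j = 0 then 0 else k choose (j - 1)) / 2 ^ k) * ?g j)"
  proof -
    have "z - b - int (k - j) *s a - int j *s b = z - int (Suc k - Suc j) *s a - int (Suc j) *s b" for j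
      by (simp add: vec_eq_iff algebra_simps)
    then have "(\<Sum>j\<le>k. ennreal ((k choose j) / 2 ^ k) * f (z - b - int (k - j) *s a - int j *s b))
        = (\<Sum>j\<le>k. ennreal ((k choose j) / 2 ^ k) * ?g (Suc j))"
      by (intro sum.cong refl arg_cong2[where f = "(*)"] arg_cong[where f = f])
    then show ?thesis unfolding sum.atMost_Suc_shift by simp
  qed
  have "(pair_avg a b ^^ Suc k) f z = ennreal (1 / 2) *
     ((\<Sum>j\<le>Suc k. ennreal ((k choose j) / 2 ^ k) * ?g j) +
      (\<Sum>j\<le>Suc k. ennreal ((if j = 0 then 0 else k choose (j - 1)) / 2 ^ k) * ?g j))"
    by (simp only: funpow.simps comp_def pair_avg_def Suc A B)
  also have "\<dots> = (\<Sum>j\<le>Suc k. ennreal ((Suc k choose j) / 2 ^ Suc k) * ?g j)"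
    unfolding sum.distrib[symmetric] sum_distrib_left
  proof (intro sum.cong refl)
    fix j assume "j \<in> {..Suc k}"
    have "real (k choose j) / 2 ^ k + real (if j = 0 then 0 else k choose (j - 1)) / 2 ^ k
        = 2 * ((Suc k choose j) / 2 ^ Suc k)"
      by (cases j) (simp_all add: field_simps)
    then have half: "1 / 2 * (real (k choose j) / 2 ^ k) + 1 / 2 * (real (if j = 0 then 0 else k choose (j - 1)) / 2 ^ k)
        = (Suc k choose j) / 2 ^ Suc k"
      by linarith
    have "ennreal (1 / 2) * (ennreal ((k choose j) / 2 ^ k) * ?g j +
       ennreal (real (if j = 0 then 0 else k choose (j - 1)) / 2 ^ k) * ?g j) =
      (ennreal (1 / 2 * (real (k choose j) / 2 ^ k)) +
       ennreal (1 / 2 * (real (if j = 0 then 0 else k choose (j - 1)) / 2 ^ k))) * ?g j"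
      by (simp only: distrib_left distrib_right mult.assoc[symmetric] ennreal_mult'[symmetric]
          divide_nonneg_nonneg zero_le_one zero_le_numeral)
    also have "\<dots> = ennreal ((Suc k choose j) / 2 ^ Suc k) * ?g j"
      unfolding half[symmetric] by (subst ennreal_plus) auto
    finally show "ennreal (1 / 2) * (ennreal ((k choose j) / 2 ^ k) * ?g j +
       ennreal (real (if j = 0 then 0 else k choose (j - 1)) / 2 ^ k) * ?g j) = ennreal ((Suc k choose j) / 2 ^ Suc k) * ?g j" .
  qed
  finally show ?case .
qed simp

text \<open>
  After \<open>k\<close> fair choices between \<open>a\<close> and \<open>b\<close> the walk sits at \<open>k *s a + j *s (b - a)\<close> with binomial
  weights in \<open>j\<close>, all of which are at most \<open>1 / sqrt (k + 1)\<close>; what remains is a sum along a line.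
\<close>

lemma funpow_pair_avg_le:
  fixes f :: "int ^ 'd \<Rightarrow> ennreal"
  assumes "\<And>z. line_sum (b - a) f z \<le> B"
  shows "(pair_avg a b ^^ k) f z \<le> ennreal (1 / sqrt (real k + 1)) * B"
proof -
  let ?y = "z - int k *s a"
  have "(pair_avg a b ^^ k) f z \<le> (\<Sum>j\<le>k. ennreal (1 / sqrt (real k + 1)) * f (?y + (- int j) *s (b - a)))"
    unfolding funpow_pair_avg
  proof (intro sum_mono mult_mono)
    fix j assume "j \<in> {..k}"
    then show "f (z - int (k - j) *s a - int j *s b) \<le> f (?y + (- int j) *s (b - a))"
      by (intro eq_refl arg_cong[where f = f]) (simp add: vec_eq_iff algebra_simps of_nat_diff)
  qed (auto intro: binomial_le_sqrt ennreal_leI)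
  also have "\<dots> = ennreal (1 / sqrt (real k + 1)) * (\<Sum>j\<in>(\<lambda>j. - int j) ` {..k}. f (?y + j *s (b - a)))"
    by (subst sum.reindex) (auto simp: sum_distrib_left inj_on_def)
  also have "\<dots> \<le> ennreal (1 / sqrt (real k + 1)) * line_sum (b - a) f ?y"
  proof (intro mult_left_mono)
    show "(\<Sum>j\<in>(\<lambda>j. - int j) ` {..k}. f (?y + j *s (b - a))) \<le> line_sum (b - a) f ?y"
      unfolding line_sum_def
      by (subst nn_integral_count_space_finite[symmetric], simp)
        (auto simp: nn_integral_count_space_indicator intro!: nn_integral_mono split: split_indicator)
  qed auto
  also have "\<dots> \<le> ennreal (1 / sqrt (real k + 1)) * B" by (intro mult_left_mono assms) auto
  finally show ?thesis .
qed

lemma inverse_diff_eq: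
  fixes x y c :: real
  assumes "0 < x" "0 < y" "(y - x) * (x + y) = c"
  shows "1 / x - 1 / y = c / (x * (y * (x + y)))"
proof -
  have "c / (x * (y * (x + y))) = ((y - x) * (x + y)) / ((x * y) * (x + y))"
    unfolding assms(3) by (simp only: mult.assoc)
  also have "\<dots> = (y - x) / (x * y)"
    using assms(1,2) by (intro nonzero_mult_divide_mult_cancel_right) simp
  also have "\<dots> = 1 / x - 1 / y"
    using assms(1,2) by (simp add: field_simps)
  finally show ?thesis ..
qed

text \<open>
  Let \<open>k\<close> count the fair choices made so far.  In each further step this count grows by one with
  probability \<open>s\<close>, so the bound \<open>1 / sqrt (k + 1)\<close> has to be averaged over a random \<open>k\<close>.  The
  function \<open>1 / sqrt u\<close> is convex, so replacing the random count by its mean \<open>k + s * m\<close> would go in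
  the wrong direction; moving at the smaller speed \<open>s / 4\<close> leaves enough room.
\<close>

lemma inverse_sqrt_supersolution:
  fixes u s :: real
  assumes u: "1 \<le> u" and s: "0 \<le> s"
  shows "(1 - s) / sqrt u + s / sqrt (u + 1) \<le> 1 / sqrt (u + s / 4)"
proof -
  define x y t where "x = sqrt u" and "y = sqrt (u + 1)" and "t = sqrt (u + s / 4)"
  have x: "1 \<le> x" "x\<^sup>2 = u" and y: "x \<le> y" "y\<^sup>2 = u + 1" and t: "x \<le> t" "t\<^sup>2 = u + s / 4"
    unfolding x_def y_def t_def using u s by simp_all
  have "0 < x" "0 < y" "0 < t" using x(1) y(1) t(1) by linarith+
  \<comment> \<open>The square root of 2, rounded up: \<open>u + 1 \<le> 2 * u\<close>.\<close>
  have "y \<le> 3 / 2 * x"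
  proof (rule power2_le_imp_le)
    show "y\<^sup>2 \<le> (3 / 2 * x)\<^sup>2"
      using u unfolding power_mult_distrib x(2) y(2) by (simp add: power_divide)
  qed (use x in simp)
  then have "y * (x + y) \<le> (3 / 2 * x) * (x + 3 / 2 * x)"
    using \<open>0 < x\<close> \<open>0 < y\<close> by (intro mult_mono) linarith+
  also have "\<dots> \<le> 4 * (x * x)"
    using \<open>0 < x\<close> by (simp add: algebra_simps)
  finally have "x * (y * (x + y)) \<le> x * (4 * (x * x))"
    using \<open>0 < x\<close> by (intro mult_left_mono) auto
  then have "1 / (x * (4 * (x * x))) \<le> 1 / (x * (y * (x + y)))"
    using \<open>0 < x\<close> \<open>0 < y\<close> by (intro divide_left_mono mult_pos_pos add_pos_pos) auto
  also have "\<dots> = 1 / x - 1 / y"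
    using \<open>0 < x\<close> \<open>0 < y\<close> x(2) y(2)
    by (intro inverse_diff_eq[symmetric]) (auto simp: power2_eq_square algebra_simps)
  finally have "s * (1 / (x * (4 * (x * x)))) \<le> s * (1 / x - 1 / y)"
    using s by (rule mult_left_mono)
  moreover have "1 / x - 1 / t \<le> s * (1 / (x * (4 * (x * x))))"
  proof -
    have "1 / x - 1 / t = (s / 4) / (x * (t * (x + t)))"
      using \<open>0 < x\<close> \<open>0 < t\<close> x(2) t(2)
      by (intro inverse_diff_eq) (auto simp: power2_eq_square algebra_simps)
    also have "\<dots> \<le> (s / 4) / (x * (x * x))"
      using \<open>0 < x\<close> \<open>0 < t\<close> t(1) s
      by (intro divide_left_mono mult_left_mono mult_mono mult_pos_pos add_pos_pos) auto
    finally show ?thesis by simp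
  qed
  ultimately have "s * (1 / x - 1 / y) \<ge> 1 / x - 1 / t" by (rule order_trans[rotated])
  then show ?thesis
    unfolding x_def[symmetric] y_def[symmetric] t_def[symmetric]
    by (simp add: right_diff_distrib diff_divide_distrib)
qed

text \<open>
  Split the step law into \<open>s\<close> times the fair choice between \<open>a\<close> and \<open>b\<close> and a remainder \<open>r\<close> of mass
  \<open>1 - s\<close>.  The number \<open>k\<close> of fair choices already made has to be carried through the induction:
  convolution with \<open>r\<close> commutes with fair choices and with line sums and contributes the factor \<open>1 - s\<close>, while a fair
  choice raises \<open>k\<close> by one.  The resulting recursion is solved by the preceding lemma.
\<close>

lemma funpow_conv_decay:
  fixes w f :: "int ^ 'd \<Rightarrow> ennreal" and a b :: "int ^ 'd"
  assumes mass: "(\<integral>\<^sup>+ c. w c \<partial>count_space UNIV) = 1"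
    and "a \<noteq> b" and s: "0 < s" and wa: "ennreal (s / 2) \<le> w a" and wb: "ennreal (s / 2) \<le> w b"
    and "\<And>z. line_sum (b - a) f z \<le> B"
  shows "(conv w ^^ m) ((pair_avg a b ^^ k) f) z \<le> ennreal (1 / sqrt (real k + 1 + s * real m / 4)) * B"
proof -
  define r where "r c = w c - ennreal (s / 2) * indicator {a, b} c" for c
  have split: "w c = r c + ennreal (s / 2) * indicator {a, b} c" for c
    using wa wb by (auto simp: r_def split: split_indicator intro!: diff_add_cancel_ennreal[symmetric])
  have ind: "(\<integral>\<^sup>+ c. g c * indicator {a, b} c \<partial>count_space UNIV) = g a + g b" for g :: "int ^ 'd \<Rightarrow> ennreal"
    using \<open>a \<noteq> b\<close> by (subst nn_integral_indicator_finite) auto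
  have conv_split: "conv w g = (\<lambda>z. conv r g z + ennreal s * pair_avg a b g z)" for g
  proof
    fix z
    have "conv w g z = (\<integral>\<^sup>+ c. r c * g (z - c) + (ennreal (s / 2) * g (z - c)) * indicator {a, b} c \<partial>count_space UNIV)"
      unfolding conv_def
    proof (intro nn_integral_cong)
      fix c
      show "w c * g (z - c) = r c * g (z - c) + (ennreal (s / 2) * g (z - c)) * indicator {a, b} c"
        by (subst split) (simp only: distrib_right, simp only: mult_ac)
    qed
    also have "\<dots> = conv r g z + (ennreal (s / 2) * g (z - a) + ennreal (s / 2) * g (z - b))"
      unfolding conv_def ind[of "\<lambda>c. ennreal (s / 2) * g (z - c)", symmetric]
      by (rule nn_integral_add) auto
    also have "ennreal (s / 2) * g (z - a) + ennreal (s / 2) * g (z - b) = ennreal s * pair_avg a b g z"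
    proof -
      have "ennreal (s / 2) = ennreal s * ennreal (1 / 2)"
        using s by (subst ennreal_mult'[symmetric]) auto
      then show ?thesis unfolding pair_avg_def by (simp only: distrib_left mult.assoc)
    qed
    finally show "conv w g z = conv r g z + ennreal s * pair_avg a b g z" .
  qed
  have mass_r: "(\<integral>\<^sup>+ c. r c \<partial>count_space UNIV) + ennreal s = 1"
  proof -
    have "1 = (\<integral>\<^sup>+ c. r c + ennreal (s / 2) * indicator {a, b} c \<partial>count_space UNIV)"
      unfolding split[symmetric] mass ..
    also have "\<dots> = (\<integral>\<^sup>+ c. r c \<partial>count_space UNIV) + (ennreal (s / 2) + ennreal (s / 2))"
      unfolding ind[of "\<lambda>c. ennreal (s / 2)", symmetric] by (rule nn_integral_add) auto
    also have "ennreal (s / 2) + ennreal (s / 2) = ennreal s"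
      using s by (subst ennreal_plus[symmetric]) auto
    finally show ?thesis ..
  qed
  then have "ennreal s \<le> ennreal 1" by (metis add.commute ennreal_1 le_iff_add)
  then have "s \<le> 1" by (subst (asm) ennreal_le_iff) auto
  have mass_r': "(\<integral>\<^sup>+ c. r c \<partial>count_space UNIV) = ennreal (1 - s)"
    using mass_r s by (metis ennreal_1 ennreal_add_diff_cancel_right ennreal_minus ennreal_neq_top less_imp_le)
  from \<open>\<And>z. line_sum (b - a) f z \<le> B\<close> show ?thesis
  proof (induction m arbitrary: k f B z)
    case 0
    then show ?case using funpow_pair_avg_le[of b a f B k z] by simp
  next
    case (Suc m)
    let ?u = "real k + 1 + s * real m / 4"
    let ?g = "(pair_avg a b ^^ k) f"
    have A: "(conv w ^^ m) (conv r ?g) z \<le> ennreal (1 / sqrt ?u) * (ennreal (1 - s) * B)"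
      unfolding funpow_pair_avg_conv[symmetric]
    proof (rule Suc.IH)
      show "line_sum (b - a) (conv r f) z \<le> ennreal (1 - s) * B" for z
        using conv_le[of "line_sum (b - a) f" B r z] Suc.prems by (simp add: line_sum_conv mass_r')
    qed
    have C: "(conv w ^^ m) (pair_avg a b ?g) z \<le> ennreal (1 / sqrt (?u + 1)) * B"
      using Suc.IH[of f B "Suc k" z] Suc.prems by (simp add: algebra_simps)
    have "(conv w ^^ Suc m) ?g z = (conv w ^^ m) (conv r ?g) z + ennreal s * (conv w ^^ m) (pair_avg a b ?g) z"
      unfolding funpow_Suc_right comp_def conv_split[of ?g] funpow_conv_add funpow_conv_cmult ..
    also have "\<dots> \<le> ennreal (1 / sqrt ?u) * (ennreal (1 - s) * B) + ennreal s * (ennreal (1 / sqrt (?u + 1)) * B)"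
      by (intro add_mono mult_left_mono A C) auto
    also have "\<dots> = ennreal ((1 - s) / sqrt ?u + s / sqrt (?u + 1)) * B"
    proof -
      have "ennreal ((1 - s) / sqrt ?u + s / sqrt (?u + 1))
          = ennreal (1 / sqrt ?u) * ennreal (1 - s) + ennreal s * ennreal (1 / sqrt (?u + 1))"
      proof -
        have "(1 - s) / sqrt ?u + s / sqrt (?u + 1) = 1 / sqrt ?u * (1 - s) + s * (1 / sqrt (?u + 1))"
          by simp
        moreover have "0 \<le> 1 / sqrt ?u * (1 - s)" "0 \<le> s * (1 / sqrt (?u + 1))"
          using s \<open>s \<le> 1\<close> by simp_all
        moreover have "ennreal (1 / sqrt ?u * (1 - s)) = ennreal (1 / sqrt ?u) * ennreal (1 - s)"
          using s by (intro ennreal_mult') simp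
        moreover have "ennreal (s * (1 / sqrt (?u + 1))) = ennreal s * ennreal (1 / sqrt (?u + 1))"
          using s by (intro ennreal_mult') simp
        ultimately show ?thesis by (simp only: ennreal_plus)
      qed
      then show ?thesis by (simp only: distrib_right mult.assoc)
    qed
    also have "\<dots> \<le> ennreal (1 / sqrt (real k + 1 + s * real (Suc m) / 4)) * B"
      using inverse_sqrt_supersolution[of ?u s] s
      by (intro mult_right_mono ennreal_leI) (auto simp: algebra_simps add_divide_distrib)
    finally show ?case .
  qed
qed

text \<open>
  One block of \<open>m\<close> steps is spent on each direction.  Summing along a line commutes with
  convolution, so the gains of the individual directions multiply.
\<close>

lemma funpow_conv_decay_directions:
  fixes w :: "int ^ 'd \<Rightarrow> ennreal"
  assumes mass: "(\<integral>\<^sup>+ c. w c \<partial>count_space UNIV) = 1" and q: "0 < q"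
    and "\<And>v. v \<in> set vs \<Longrightarrow> \<exists>a b. a \<noteq> b \<and> v = b - a \<and> ennreal q \<le> w a \<and> ennreal q \<le> w b"
    and "\<And>z. fold line_sum vs f z \<le> B"
  shows "(conv w ^^ (m * length vs)) f z \<le> ennreal ((1 / sqrt (1 + q * real m / 2)) ^ length vs) * B"
  using assms(3,4)
proof (induction vs arbitrary: f z)
  case Nil
  then show ?case by simp
next
  case (Cons v vs)
  let ?\<beta> = "1 / sqrt (1 + q * real m / 2)"
  obtain a b where ab: "a \<noteq> b" "v = b - a" "ennreal q \<le> w a" "ennreal q \<le> w b"
    using Cons.prems(1)[of v] by auto
  have "line_sum (b - a) ((conv w ^^ (m * length vs)) f) y \<le> ennreal (?\<beta> ^ length vs) * B" for y
    unfolding line_sum_funpow_conv ab(2)[symmetric] using Cons.prems by (intro Cons.IH) auto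
  from funpow_conv_decay[OF mass ab(1) _ _ _ this, of "2 * q" m 0 z]
  have "(conv w ^^ m) ((conv w ^^ (m * length vs)) f) z \<le> ennreal ?\<beta> * (ennreal (?\<beta> ^ length vs) * B)"
    using q ab(3,4) by simp
  then show ?case
    using q by (simp add: funpow_add mult.assoc[symmetric] ennreal_mult'[symmetric])
qed

lemma real_vec_add: "real_vec (x + y) = real_vec x + real_vec y"
  and real_vec_diff: "real_vec (x - y) = real_vec x - real_vec y"
  and real_vec_scale: "real_vec (j *s x) = real_of_int j *\<^sub>R real_vec x"
  and real_vec_0: "real_vec 0 = 0"
  by (simp_all add: real_vec_def vec_eq_iff)

lemma real_vec_eq_iff: "real_vec x = real_vec y \<longleftrightarrow> x = y"
  by (simp add: real_vec_def vec_eq_iff)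

text \<open>
  A line in a direction outside the span of \<open>S\<close> meets each translate of that span at most once, so
  summing along it does not add up several contributions.
\<close>

lemma line_sum_span_le:
  fixes f :: "int ^ 'd \<Rightarrow> ennreal"
  assumes f: "\<And>z. f z \<le> indicator {z. real_vec z \<in> span S} z" and v: "real_vec v \<notin> span S"
  shows "line_sum v f z \<le> indicator {z. real_vec z \<in> span (insert (real_vec v) S)} z"
proof -
  define J where "J = {j. real_vec (z + j *s v) \<in> span S}"
  have uniq: "i = j" if "i \<in> J" "j \<in> J" for i j
  proof (rule ccontr)
    assume "i \<noteq> j"
    have "(real_of_int i - real_of_int j) *\<^sub>R real_vec v \<in> span S"
      using span_diff[OF that[unfolded J_def mem_Collect_eq]]
      by (simp add: real_vec_add real_vec_scale scaleR_diff_left)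
    then have "(1 / (real_of_int i - real_of_int j)) *\<^sub>R (real_of_int i - real_of_int j) *\<^sub>R real_vec v \<in> span S"
      by (rule span_scale)
    with \<open>i \<noteq> j\<close> v show False by simp
  qed
  have "line_sum v f z \<le> (\<integral>\<^sup>+ j. indicator J j \<partial>count_space UNIV)"
    unfolding line_sum_def
  proof (intro nn_integral_mono)
    show "f (z + j *s v) \<le> indicator J j" for j
      using f[of "z + j *s v"] by (auto simp: J_def split: split_indicator_asm split_indicator)
  qed
  also have "\<dots> = emeasure (count_space UNIV) J" by simp
  also have "\<dots> \<le> indicator {z. real_vec z \<in> span (insert (real_vec v) S)} z"
  proof (cases "J = {}")
    case False
    then obtain j where j: "j \<in> J" by auto
    with uniq have "J = {j}" by blast
    moreover have "real_vec z \<in> span (insert (real_vec v) S)"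
    proof -
      have "real_vec (z + j *s v) \<in> span (insert (real_vec v) S)"
        using j span_mono[of S "insert (real_vec v) S"] by (auto simp: J_def)
      moreover have "real_of_int j *\<^sub>R real_vec v \<in> span (insert (real_vec v) S)"
        by (intro span_scale span_base) simp
      ultimately show ?thesis
        using span_diff by (fastforce simp: real_vec_add real_vec_scale)
    qed
    ultimately show ?thesis by simp
  qed simp
  finally show ?thesis .
qed

lemma fold_line_sum_le_1:
  fixes f :: "int ^ 'd \<Rightarrow> ennreal"
  assumes "\<And>z. f z \<le> indicator {z. real_vec z \<in> span S} z"
    and "distinct vs" and "real_vec ` set vs \<inter> S = {}" and "independent (S \<union> real_vec ` set vs)"
  shows "fold line_sum vs f z \<le> 1"
  using assms
proof (induction vs arbitrary: f S)
  case Nil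
  show ?case using Nil(1)[of z] by (auto split: split_indicator_asm intro: order_trans)
next
  case (Cons v vs)
  have "independent (insert (real_vec v) S)"
    using Cons.prems(4) by (rule independent_mono) auto
  then have "real_vec v \<notin> span S"
    using Cons.prems(3) by (auto simp: independent_insert)
  then have "\<And>z. line_sum v f z \<le> indicator {z. real_vec z \<in> span (insert (real_vec v) S)} z"
    by (rule line_sum_span_le[OF Cons.prems(1)])
  then have "fold line_sum vs (line_sum v f) z \<le> 1"
    using Cons.prems by (intro Cons.IH[where S = "insert (real_vec v) S"]) (auto simp: real_vec_eq_iff)
  then show ?case by simp
qed

text \<open>
  Starting from a point mass, the iterated line sums in independent directions never exceed \<open>1\<close>,
  so that only the decay factors remain.
\<close>

lemma funpow_conv_delta_le:
  fixes w :: "int ^ 'd \<Rightarrow> ennreal"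
  assumes mass: "(\<integral>\<^sup>+ c. w c \<partial>count_space UNIV) = 1" and q: "0 < q"
    and steps: "\<And>v. v \<in> set vs \<Longrightarrow> \<exists>a b. a \<noteq> b \<and> v = b - a \<and> ennreal q \<le> w a \<and> ennreal q \<le> w b"
    and vs: "distinct vs" "independent (real_vec ` set vs)"
  shows "\<exists>c\<ge>0. \<forall>n\<ge>1. \<forall>z. (conv w ^^ n) (indicator {0}) z \<le> ennreal (c * real n powr (- real (length vs) / 2))"
proof (cases "vs = []")
  case True
  have "(conv w ^^ n) (indicator {0}) z \<le> 1" for n z
    by (rule funpow_conv_le[OF mass]) (simp split: split_indicator)
  with True show ?thesis by (intro exI[of _ 1]) simp
next
  case False
  define r where "r = length vs"
  define \<kappa> where "\<kappa> = min 1 (q / 2) / real r"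
  have r: "r > 0" using False by (simp add: r_def)
  have \<kappa>: "\<kappa> > 0" using q r by (simp add: \<kappa>_def)
  have "(conv w ^^ n) (indicator {0}) z \<le> ennreal (\<kappa> powr (- real r / 2) * real n powr (- real r / 2))"
    if "n \<ge> 1" for n z
  proof -
    define m where "m = n div r"
    have one: "fold line_sum vs (indicator {0} :: int ^ 'd \<Rightarrow> ennreal) z \<le> 1" for z
      using vs by (intro fold_line_sum_le_1[where S = "{}"])
        (auto simp: real_vec_0 split: split_indicator)
    \<comment> \<open>Only the first \<open>m * r\<close> of the \<open>n\<close> steps are used for spreading; the other ones do no harm.\<close>
    have "(conv w ^^ (m * length vs)) (indicator {0}) z \<le> ennreal ((1 / sqrt (1 + q * real m / 2)) ^ r)" for z
      using funpow_conv_decay_directions[OF mass q steps one, of m z] by (simp add: r_def)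
    then have "(conv w ^^ (n mod r)) ((conv w ^^ (m * r)) (indicator {0})) z \<le> ennreal ((1 / sqrt (1 + q * real m / 2)) ^ r)"
      unfolding r_def by (rule funpow_conv_le[OF mass])
    moreover have "(conv w ^^ n) (indicator {0}) z = (conv w ^^ (n mod r)) ((conv w ^^ (m * r)) (indicator {0})) z"
      unfolding m_def using funpow_add[of "n mod r" "n div r * r" "conv w"] by simp
    moreover have "(1 / sqrt (1 + q * real m / 2)) ^ r \<le> \<kappa> powr (- real r / 2) * real n powr (- real r / 2)"
    proof -
      have "n \<le> r * (m + 1)"
        using dividend_less_times_div[of r n] r by (simp add: m_def)
      then have "real n \<le> real r * (real m + 1)" 
        using of_nat_mono[of n "r * (m + 1)", where 'a = real] by (simp add: algebra_simps)
      then have "\<kappa> * real n \<le> \<kappa> * (real r * (real m + 1))"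
        using \<kappa> by (intro mult_left_mono) auto
      also have "\<dots> = min 1 (q / 2) * (real m + 1)"
        using r by (simp add: \<kappa>_def)
      also have "\<dots> \<le> 1 + q * real m / 2"
      proof -
        have "min 1 (q / 2) * real m \<le> q / 2 * real m" by (intro mult_right_mono) auto
        moreover have "min 1 (q / 2) \<le> 1" by simp
        ultimately show ?thesis unfolding distrib_left mult_1_right times_divide_eq_left by linarith
      qed
      finally have le: "\<kappa> * real n \<le> 1 + q * real m / 2" .
      have "(1 / sqrt (1 + q * real m / 2)) ^ r = (1 + q * real m / 2) powr (- real r / 2)"
      proof -
        have pos: "0 < 1 + q * real m / 2" using q by (simp add: add_pos_nonneg)
        then have "1 / sqrt (1 + q * real m / 2) = (1 + q * real m / 2) powr (- 1 / 2)"
          by (simp add: powr_minus_divide powr_half_sqrt)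
        then show ?thesis using pos by (simp add: powr_powr flip: powr_realpow)
      qed
      also have "\<dots> \<le> (\<kappa> * real n) powr (- real r / 2)"
        using le \<kappa> that by (intro powr_mono2') auto
      also have "\<dots> = \<kappa> powr (- real r / 2) * real n powr (- real r / 2)"
        using \<kappa> by (simp add: powr_mult)
      finally show ?thesis .
    qed
    ultimately show ?thesis by (simp only:) (rule order_trans, assumption, rule ennreal_leI)
  qed
  then show ?thesis unfolding r_def[symmetric] by (intro exI[of _ "\<kappa> powr (- real r / 2)"]) auto
qed

section \<open>Random walks with centred nondegenerate steps\<close>

locale lattice_walk = prob_space M for M :: "'a measure" +
  fixes \<xi> :: "nat \<Rightarrow> 'a \<Rightarrow> int ^ 'd"
  assumes steps_indep: "indep_vars (\<lambda>_. count_space UNIV) \<xi> {1..}"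
    and steps_ident: "\<And>i. i \<ge> 1 \<Longrightarrow> distr M (count_space UNIV) (\<xi> i) = distr M (count_space UNIV) (\<xi> 1)"
    and steps_integrable: "integrable M (\<lambda>\<omega>. real_vec (\<xi> 1 \<omega>))"
    and steps_mean: "expectation (\<lambda>\<omega>. real_vec (\<xi> 1 \<omega>)) = 0"
    and steps_nondegenerate: "\<And>u. norm u = 1 \<Longrightarrow> \<P>(\<omega> in M. real_vec (\<xi> 1 \<omega>) \<bullet> u = 0) < 1"
begin

definition incr :: "nat \<Rightarrow> nat \<Rightarrow> 'a \<Rightarrow> int ^ 'd" where
  "incr s t \<omega> = (\<Sum>i\<in>{s<..t}. \<xi> i \<omega>)"

lemma step_measurable: "1 \<le> i \<Longrightarrow> \<xi> i \<in> M \<rightarrow>\<^sub>M count_space UNIV"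
  using steps_indep by (auto simp: indep_vars_def)

lemma PiM_count_space: "finite A \<Longrightarrow> (\<Pi>\<^sub>M i\<in>A. count_space (UNIV :: (int ^ 'd) set)) = count_space (Pi\<^sub>E A (\<lambda>_. UNIV))"
  by (rule count_space_PiM_finite) auto

lemma steps_event:
  assumes "finite A" "A \<subseteq> {1..}"
  shows "{\<omega> \<in> space M. P (\<lambda>i\<in>A. \<xi> i \<omega>)} \<in> events"
proof -
  have "(\<lambda>\<omega>. \<lambda>i\<in>A. \<xi> i \<omega>) \<in> M \<rightarrow>\<^sub>M (\<Pi>\<^sub>M i\<in>A. count_space UNIV)"
    using assms by (intro measurable_restrict step_measurable) auto
  then have "(\<lambda>\<omega>. \<lambda>i\<in>A. \<xi> i \<omega>) \<in> M \<rightarrow>\<^sub>M count_space (Pi\<^sub>E A (\<lambda>_. UNIV))"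
    by (simp only: PiM_count_space[OF assms(1)])
  moreover have "Measurable.pred (count_space (Pi\<^sub>E A (\<lambda>_. UNIV))) P" by simp
  ultimately show ?thesis by measurable
qed

lemma disjoint_blocks_indep:
  assumes "finite A" "A \<subseteq> {1..}" "finite B" "B \<subseteq> {1..}" "A \<inter> B = {}"
  shows "\<P>(\<omega> in M. P (\<lambda>i\<in>A. \<xi> i \<omega>) \<and> Q (\<lambda>i\<in>B. \<xi> i \<omega>)) =
    \<P>(\<omega> in M. P (\<lambda>i\<in>A. \<xi> i \<omega>)) * \<P>(\<omega> in M. Q (\<lambda>i\<in>B. \<xi> i \<omega>))"
proof -
  have "indep_var (PiM A (\<lambda>_. count_space UNIV)) (\<lambda>\<omega>. \<lambda>i\<in>A. \<xi> i \<omega>)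
     (PiM B (\<lambda>_. count_space UNIV)) (\<lambda>\<omega>. \<lambda>i\<in>B. \<xi> i \<omega>)"
    using assms by (intro indep_var_restrict[OF steps_indep]) auto
  moreover have "{x \<in> Pi\<^sub>E A (\<lambda>_. UNIV). P x} \<in> sets (\<Pi>\<^sub>M i\<in>A. count_space (UNIV :: (int ^ 'd) set))"
    "{x \<in> Pi\<^sub>E B (\<lambda>_. UNIV). Q x} \<in> sets (\<Pi>\<^sub>M i\<in>B. count_space (UNIV :: (int ^ 'd) set))"
    using assms by (auto simp: PiM_count_space)
  ultimately have *: "prob ((\<lambda>x. (\<lambda>i\<in>A. \<xi> i x, \<lambda>i\<in>B. \<xi> i x)) -`
      ({x \<in> Pi\<^sub>E A (\<lambda>_. UNIV). P x} \<times> {x \<in> Pi\<^sub>E B (\<lambda>_. UNIV). Q x}) \<inter> space M) =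
    prob ((\<lambda>\<omega>. \<lambda>i\<in>A. \<xi> i \<omega>) -` {x \<in> Pi\<^sub>E A (\<lambda>_. UNIV). P x} \<inter> space M) *
    prob ((\<lambda>\<omega>. \<lambda>i\<in>B. \<xi> i \<omega>) -` {x \<in> Pi\<^sub>E B (\<lambda>_. UNIV). Q x} \<inter> space M)"
    by (rule indep_varD)
  show ?thesis
    by (rule trans[OF trans[OF _ *]]; (intro arg_cong2[where f = "(*)"])?; intro arg_cong[where f = prob]) auto
qed

text \<open>
  A translation \<open>f\<close> shifts the time, a reflection reverses it.
\<close>

lemma steps_exchangeable:
  assumes I: "finite I" "I \<noteq> {}" "I \<subseteq> {1..}" and f: "inj_on f I" "f ` I \<subseteq> {1..}"
  shows "\<P>(\<omega> in M. P (\<lambda>i\<in>I. \<xi> (f i) \<omega>)) = \<P>(\<omega> in M. P (\<lambda>i\<in>I. \<xi> i \<omega>))"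
proof -
  have law: "distr M (\<Pi>\<^sub>M i\<in>I. count_space UNIV) (\<lambda>\<omega>. \<lambda>i\<in>I. \<xi> (g i) \<omega>)
      = (\<Pi>\<^sub>M i\<in>I. distr M (count_space UNIV) (\<xi> 1))" if g: "inj_on g I" "g ` I \<subseteq> {1..}" for g
  proof -
    have "indep_vars (\<lambda>j. PiM {g j} (\<lambda>_. count_space UNIV)) (\<lambda>j \<omega>. restrict (\<lambda>i. \<xi> i \<omega>) {g j}) I"
      using g by (intro indep_vars_restrict[OF steps_indep]) (auto simp: disjoint_family_on_def inj_on_def)
    then have "indep_vars (\<lambda>_. count_space UNIV) (\<lambda>j \<omega>. (restrict (\<lambda>i. \<xi> i \<omega>) {g j}) (g j)) I"
      by (rule indep_vars_compose2) (auto intro: measurable_component_singleton)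
    then have "indep_vars (\<lambda>_. count_space UNIV) (\<lambda>j. \<xi> (g j)) I" by simp
    then have "distr M (\<Pi>\<^sub>M i\<in>I. count_space UNIV) (\<lambda>\<omega>. \<lambda>i\<in>I. \<xi> (g i) \<omega>)
      = (\<Pi>\<^sub>M i\<in>I. distr M (count_space UNIV) (\<xi> (g i)))"
      using g I by (subst (asm) indep_vars_iff_distr_eq_PiM') (auto intro!: step_measurable)
    also have "\<dots> = (\<Pi>\<^sub>M i\<in>I. distr M (count_space UNIV) (\<xi> 1))"
      using g by (intro PiM_cong steps_ident) auto
    finally show ?thesis .
  qed
  let ?S = "{x \<in> Pi\<^sub>E I (\<lambda>_. UNIV). P x}"
  have S: "?S \<in> sets (\<Pi>\<^sub>M i\<in>I. count_space (UNIV :: (int ^ 'd) set))"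
    using I by (auto simp: PiM_count_space)
  have *: "\<P>(\<omega> in M. P (\<lambda>i\<in>I. \<xi> (g i) \<omega>)) = measure (\<Pi>\<^sub>M i\<in>I. distr M (count_space UNIV) (\<xi> 1)) ?S"
    if g: "inj_on g I" "g ` I \<subseteq> {1..}" for g
  proof -
    have m: "(\<lambda>\<omega>. \<lambda>i\<in>I. \<xi> (g i) \<omega>) \<in> M \<rightarrow>\<^sub>M (\<Pi>\<^sub>M i\<in>I. count_space UNIV)"
      using g I by (intro measurable_restrict step_measurable) auto
    show ?thesis unfolding law[OF g, symmetric] measure_distr[OF m S]
      by (intro arg_cong[where f = prob]) auto
  qed
  show ?thesis using *[OF f] *[of "\<lambda>i. i"] I by simp
qed

lemma incr_eq_restrict:
  assumes "{s<..t} \<subseteq> A"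
  shows "incr s t \<omega> = (\<Sum>i\<in>{s<..t}. (\<lambda>i\<in>A. \<xi> i \<omega>) i)"
  unfolding incr_def using assms by (intro sum.cong) auto

lemma incr_event: "{\<omega> \<in> space M. P (incr s t \<omega>)} \<in> events"
  unfolding incr_eq_restrict[OF subset_refl] by (rule steps_event) auto

lemma emeasure_incr:
  "emeasure M {\<omega> \<in> space M. incr s (s + n) \<omega> = z} =
     (conv (\<lambda>b. emeasure M {\<omega> \<in> space M. \<xi> 1 \<omega> = b}) ^^ n) (indicator {0}) z"
proof (induction n arbitrary: z)
  case 0
  show ?case by (auto simp: incr_def emeasure_space_1 split: split_indicator)
next
  case (Suc n)
  let ?t = "s + n"
  let ?E = "\<lambda>b. {\<omega> \<in> space M. \<xi> (Suc ?t) \<omega> = b \<and> incr s ?t \<omega> = z - b}"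
  have split: "incr s (Suc ?t) \<omega> = incr s ?t \<omega> + \<xi> (Suc ?t) \<omega>" for \<omega>
  proof -
    have "{s<..Suc ?t} = insert (Suc ?t) {s<..?t}" by auto
    then show ?thesis by (simp add: incr_def add.commute)
  qed
  have ev: "{\<omega> \<in> space M. \<xi> (Suc ?t) \<omega> = b} \<in> events" for b
    using step_measurable[of "Suc ?t"] by measurable
  have E: "emeasure M (?E b) = emeasure M {\<omega> \<in> space M. \<xi> 1 \<omega> = b} * emeasure M {\<omega> \<in> space M. incr s ?t \<omega> = z - b}" for b
  proof -
    have "{s<..?t} \<subseteq> {1..}" by auto
    then have "\<P>(\<omega> in M. \<xi> (Suc ?t) \<omega> = b \<and> incr s ?t \<omega> = z - b) =
       \<P>(\<omega> in M. \<xi> (Suc ?t) \<omega> = b) * \<P>(\<omega> in M. incr s ?t \<omega> = z - b)"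
      using disjoint_blocks_indep[of "{Suc ?t}" "{s<..?t}" "\<lambda>x. x (Suc ?t) = b" "\<lambda>x. (\<Sum>i\<in>{s<..?t}. x i) = z - b"]
      by (simp add: incr_eq_restrict[OF subset_refl])
    also have "\<P>(\<omega> in M. \<xi> (Suc ?t) \<omega> = b) = \<P>(\<omega> in M. \<xi> 1 \<omega> = b)"
      using steps_exchangeable[of "{1}" "\<lambda>_. Suc ?t" "\<lambda>x. x 1 = b"] by simp
    finally show ?thesis by (simp add: emeasure_eq_measure ennreal_mult)
  qed
  have "{\<omega> \<in> space M. incr s (s + Suc n) \<omega> = z} = (\<Union>b. ?E b)"
    by (auto simp: split)
  also have "emeasure M \<dots> = (\<integral>\<^sup>+ b. emeasure M (?E b) \<partial>count_space UNIV)"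
  proof (rule emeasure_UN_countable)
    have "?E b = {\<omega> \<in> space M. \<xi> (Suc ?t) \<omega> = b} \<inter> {\<omega> \<in> space M. incr s ?t \<omega> = z - b}" for b by auto
    then show "?E b \<in> events" for b using ev incr_event by auto
  qed (auto simp: disjoint_family_on_def)
  finally show ?case unfolding E by (simp add: Suc conv_def)
qed

lemma step_law_mass: "(\<integral>\<^sup>+ b. emeasure M {\<omega> \<in> space M. \<xi> 1 \<omega> = b} \<partial>count_space UNIV) = 1"
proof -
  have "{\<omega> \<in> space M. \<xi> 1 \<omega> = b} \<in> events" for b
    using step_measurable[of 1] by measurable
  then have "(\<integral>\<^sup>+ b. emeasure M {\<omega> \<in> space M. \<xi> 1 \<omega> = b} \<partial>count_space UNIV) =
      emeasure M (\<Union>b. {\<omega> \<in> space M. \<xi> 1 \<omega> = b})"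
    by (intro emeasure_UN_countable[symmetric]) (auto simp: disjoint_family_on_def)
  also have "(\<Union>b. {\<omega> \<in> space M. \<xi> 1 \<omega> = b}) = space M" by auto
  finally show ?thesis by (simp add: emeasure_space_1)
qed

lemma step_in_support: "AE \<omega> in M. 0 < \<P>(\<omega>' in M. \<xi> 1 \<omega>' = \<xi> 1 \<omega>)"
proof -
  have "AE \<omega> in M. \<forall>a. \<P>(\<omega>' in M. \<xi> 1 \<omega>' = a) = 0 \<longrightarrow> \<xi> 1 \<omega> \<noteq> a"
  proof (subst AE_all_countable, intro allI)
    fix a
    have "{\<omega> \<in> space M. \<xi> 1 \<omega> = a} \<in> events"
      using step_measurable[of 1] by measurable
    then show "AE \<omega> in M. \<P>(\<omega>' in M. \<xi> 1 \<omega>' = a) = 0 \<longrightarrow> \<xi> 1 \<omega> \<noteq> a"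
      using prob_Collect_eq_0[of "\<lambda>\<omega>. \<xi> 1 \<omega> = a"] by auto
  qed
  then show ?thesis
    by eventually_elim (use zero_less_measure_iff in fastforce)
qed

text \<open>
  If all differences of support points were orthogonal to a unit vector \<open>e\<close>, the component of the
  step in direction \<open>e\<close> would be almost surely constant.  The constant is its mean, which is zero,
  contrary to nondegeneracy.  Centring is what turns the linear condition of nondegeneracy into the
  affine one needed here.
\<close>

lemma support_differences_span:
  assumes a: "0 < \<P>(\<omega> in M. \<xi> 1 \<omega> = a)"
  shows "span (real_vec ` (\<lambda>b. b - a) ` {b. 0 < \<P>(\<omega> in M. \<xi> 1 \<omega> = b)}) = UNIV" (is "span ?D = _")
proof (rule ccontr)
  assume "span ?D \<noteq> UNIV"
  from span_not_univ_subset_hyperplane[OF this]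
  obtain u where "u \<noteq> 0" "span ?D \<subseteq> {x. u \<bullet> x = 0}" by (elim exE conjE) (rule that)
  with span_superset[of ?D] have u: "u \<noteq> 0" "?D \<subseteq> {x. u \<bullet> x = 0}" by (simp, blast)
  define e where "e = u /\<^sub>R norm u"
  have e: "norm e = 1" using u by (simp add: e_def)
  have orth: "real_vec b \<bullet> e = real_vec a \<bullet> e" if "0 < \<P>(\<omega> in M. \<xi> 1 \<omega> = b)" for b
  proof -
    have "real_vec (b - a) \<in> ?D" using that by (intro imageI CollectI)
    with u(2) have "u \<bullet> real_vec (b - a) = 0" by (rule subsetD[THEN CollectD])
    then show ?thesis by (simp add: e_def real_vec_diff inner_diff_right inner_commute)
  qed
  have AE: "AE \<omega> in M. real_vec (\<xi> 1 \<omega>) \<bullet> e = real_vec a \<bullet> e"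
    using step_in_support by eventually_elim (rule orth)
  have meas[measurable]: "(\<lambda>\<omega>. real_vec (\<xi> 1 \<omega>) \<bullet> e) \<in> borel_measurable M"
    using steps_integrable by (intro borel_measurable_inner borel_measurable_integrable) auto
  have "expectation (\<lambda>\<omega>. real_vec (\<xi> 1 \<omega>) \<bullet> e) = expectation (\<lambda>_. real_vec a \<bullet> e)"
    by (rule integral_cong_AE[OF meas _ AE]) simp
  then have "real_vec a \<bullet> e = expectation (\<lambda>\<omega>. real_vec (\<xi> 1 \<omega>) \<bullet> e)"
    by (simp add: prob_space)
  also have "\<dots> = 0" using steps_integrable steps_mean by simp
  finally have "AE \<omega> in M. real_vec (\<xi> 1 \<omega>) \<bullet> e = 0" using AE by simp
  moreover have "{\<omega> \<in> space M. real_vec (\<xi> 1 \<omega>) \<bullet> e = 0} \<in> events"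
    using meas by measurable
  ultimately have "\<P>(\<omega> in M. real_vec (\<xi> 1 \<omega>) \<bullet> e = 0) = 1"
    by (simp only: prob_Collect_eq_1)
  with steps_nondegenerate[OF e] show False by simp
qed

text \<open>
  A basis can be chosen among the differences \<open>b - a\<close> of support points, with a fixed \<open>a\<close>.  It is
  finite, so the masses of the points involved are bounded away from zero.
\<close>

lemma heat_kernel_bound:
  "\<exists>c\<ge>0. \<forall>s n z. 1 \<le> n \<longrightarrow> \<P>(\<omega> in M. incr s (s + n) \<omega> = z) \<le> c * real n powr (- real CARD('d) / 2)"
proof -
  let ?P = "\<lambda>b. \<P>(\<omega> in M. \<xi> 1 \<omega> = b)"
  have "\<exists>a. 0 < ?P a"
  proof (rule ccontr)
    assume "\<nexists>a. 0 < ?P a"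
    then have "AE \<omega> in M. False" using step_in_support by auto
    then show False by simp
  qed
  then obtain a where a: "0 < ?P a" by auto
  let ?D = "real_vec ` (\<lambda>b. b - a) ` {b. 0 < ?P b}"
  obtain B where B: "B \<subseteq> ?D" "independent B" "?D \<subseteq> span B"
    using maximal_independent_subset[of ?D] by auto
  have "span B = UNIV"
    using support_differences_span[OF a] span_minimal[OF B(3) subspace_span] by auto
  then have card_B: "card B = CARD('d)"
    using basis_card_eq_dim[of B UNIV] B(2) by simp
  define V where "V = {v. real_vec v \<in> B}"
  have BV: "real_vec ` V = B" using B(1) by (auto simp: V_def)
  have inj: "inj_on (real_vec :: int ^ 'd \<Rightarrow> _) V" by (auto simp: inj_on_def real_vec_eq_iff)
  have "finite B" using B(2) by (rule finiteI_independent)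
  then have "finite V" using BV inj finite_image_iff by blast
  then obtain vs where vs: "set vs = V" "distinct vs" using finite_distinct_list by blast
  have len: "length vs = CARD('d)"
    using card_image[OF inj] BV card_B vs distinct_card by metis
  have V: "0 < ?P (a + v)" "v \<noteq> 0" if "v \<in> V" for v
  proof -
    have "real_vec v \<in> ?D" using that B(1) unfolding V_def by blast
    then obtain b where "real_vec v = real_vec (b - a)" "0 < ?P b" by (elim imageE) simp
    then have "v = b - a" by (simp only: real_vec_eq_iff)
    then show "0 < ?P (a + v)" using \<open>0 < ?P b\<close> by simp
    have "0 \<notin> B" using B(2) dependent_zero by blast
    then show "v \<noteq> 0" using that by (auto simp: V_def real_vec_0)
  qed
  define q where "q = Min (?P ` insert a ((+) a ` V))"
  have "0 < q" unfolding q_def using a V \<open>finite V\<close> by (subst Min_gr_iff) auto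
  have "ennreal q \<le> emeasure M {\<omega> \<in> space M. \<xi> 1 \<omega> = b}" if "b \<in> insert a ((+) a ` V)" for b
  proof -
    have "q \<le> ?P b" unfolding q_def using that \<open>finite V\<close> by (intro Min_le) auto
    then show ?thesis by (simp add: emeasure_eq_measure ennreal_leI)
  qed
  then have "\<exists>a' b. a' \<noteq> b \<and> v = b - a' \<and> ennreal q \<le> emeasure M {\<omega> \<in> space M. \<xi> 1 \<omega> = a'}
      \<and> ennreal q \<le> emeasure M {\<omega> \<in> space M. \<xi> 1 \<omega> = b}" if "v \<in> set vs" for v
    using that V(2)[of v] vs(1) by (intro exI[of _ a] exI[of _ "a + v"]) auto
  from funpow_conv_delta_le[OF step_law_mass \<open>0 < q\<close> this vs(2)] B(2) len
  obtain c where c: "0 \<le> c" "\<And>n z. 1 \<le> n \<Longrightarrow>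
      (conv (\<lambda>b. emeasure M {\<omega> \<in> space M. \<xi> 1 \<omega> = b}) ^^ n) (indicator {0}) z
        \<le> ennreal (c * real n powr (- real CARD('d) / 2))"
    unfolding vs(1) BV by auto
  have "\<P>(\<omega> in M. incr s (s + n) \<omega> = z) \<le> c * real n powr (- real CARD('d) / 2)" if "1 \<le> n" for s n z
  proof -
    have "emeasure M {\<omega> \<in> space M. incr s (s + n) \<omega> = z} \<le> ennreal (c * real n powr (- real CARD('d) / 2))"
      unfolding emeasure_incr by (rule c(2)[OF that])
    then show ?thesis using c(1) by (simp add: emeasure_eq_measure)
  qed
  with c(1) show ?thesis by blast
qed

text \<open>
  Reversing the order of the steps in \<open>{s<..t}\<close> turns the final segments of the window into
  initial segments, so the event has the probability that the walk avoids \<open>0\<close> at the times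
  \<open>1, \<dots>, t - s\<close>.
\<close>

lemma no_return_window_prob:
  assumes "s < t"
  shows "no_return_prob M \<xi> \<le> \<P>(\<omega> in M. \<forall>k\<in>{s..<t}. incr k t \<omega> \<noteq> 0)"
proof -
  define h where "h = t - s"
  have h: "1 \<le> h" "h \<le> t" "s = t - h" using assms by (auto simp: h_def)
  let ?Q = "\<lambda>x :: nat \<Rightarrow> int ^ 'd. \<forall>m\<in>{1..h}. (\<Sum>i=1..m. x i) \<noteq> 0"
  let ?f = "\<lambda>i. t + 1 - i"
  have Q: "?Q (\<lambda>i\<in>{1..h}. y i) \<longleftrightarrow> (\<forall>m\<in>{1..h}. (\<Sum>i=1..m. y i) \<noteq> 0)" for y
  proof -
    have "(\<Sum>i=1..m. (\<lambda>i\<in>{1..h}. y i) i) = (\<Sum>i=1..m. y i)" if "m \<in> {1..h}" for m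
      using that by (intro sum.cong) auto
    then show ?thesis by simp
  qed
  have "incr (t - m) t \<omega> = (\<Sum>i=1..m. \<xi> (?f i) \<omega>)" if "m \<le> t" for m \<omega>
    unfolding incr_def using that
    by (intro sum.reindex_bij_witness[where i = ?f and j = ?f]) auto
  then have rev: "(\<forall>k\<in>{s..<t}. incr k t \<omega> \<noteq> 0) \<longleftrightarrow> ?Q (\<lambda>i\<in>{1..h}. \<xi> (?f i) \<omega>)" for \<omega>
  proof -
    have "{s..<t} = (\<lambda>m. t - m) ` {1..h}"
    proof safe
      fix k assume "k \<in> {s..<t}"
      then show "k \<in> (\<lambda>m. t - m) ` {1..h}" using h by (intro image_eqI[of _ _ "t - k"]) auto
    qed (use h in auto)
    then show ?thesis unfolding Q using h \<open>\<And>m \<omega>. m \<le> t \<Longrightarrow> incr (t - m) t \<omega> = _\<close> by auto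
  qed
  have "no_return_prob M \<xi> \<le> \<P>(\<omega> in M. ?Q (\<lambda>i\<in>{1..h}. \<xi> i \<omega>))"
    unfolding no_return_prob_def
    by (intro finite_measure_mono steps_event) (auto simp: Q)
  also have "\<dots> = \<P>(\<omega> in M. ?Q (\<lambda>i\<in>{1..h}. \<xi> (?f i) \<omega>))"
    using h by (intro steps_exchangeable[symmetric]) (auto simp: inj_on_def)
  finally show ?thesis by (simp only: rev)
qed

end

section \<open>Densities of random sets of times\<close>

text \<open>
  This is Kronecker's lemma for nonnegative terms.
\<close>

lemma Cesaro_mean_tendsto_0:
  fixes a :: "nat \<Rightarrow> real"
  assumes nonneg: "\<And>j. 0 \<le> a j" and summ: "summable (\<lambda>j. a j / real j)"
  shows "(\<lambda>n. (\<Sum>j=1..n. a j) / real n) \<longlonglongrightarrow> 0"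
proof (rule LIMSEQ_I)
  fix e :: real assume "0 < e"
  then obtain N where N: "\<And>m n. N \<le> m \<Longrightarrow> \<bar>\<Sum>j\<in>{m..<n}. a j / real j\<bar> < e / 2"
    using summ unfolding summable_Cauchy by (metis half_gt_zero real_norm_def)
  have "(\<lambda>n. (\<Sum>j=1..N. a j) / real n) \<longlonglongrightarrow> 0"
    by (rule lim_const_over_n)
  then have "\<forall>\<^sub>F n in sequentially. (\<Sum>j=1..N. a j) / real n < e / 2"
    using \<open>0 < e\<close> by (intro order_tendstoD) auto
  then obtain N' where N': "\<And>n. N' \<le> n \<Longrightarrow> (\<Sum>j=1..N. a j) / real n < e / 2"
    unfolding eventually_sequentially by blast
  show "\<exists>n0. \<forall>n\<ge>n0. norm ((\<Sum>j=1..n. a j) / real n - 0) < e"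
  proof (intro exI allI impI)
    fix n assume n: "max 1 (max N N') \<le> n"
    have "(\<Sum>j=1..n. a j) = (\<Sum>j=1..N. a j) + (\<Sum>j\<in>{Suc N..<Suc n}. a j)"
      using n sum.ub_add_nat[of 1 N a "n - N"] by (simp add: atLeastLessThanSuc_atLeastAtMost)
    also have "(\<Sum>j\<in>{Suc N..<Suc n}. a j) \<le> (\<Sum>j\<in>{Suc N..<Suc n}. real n * (a j / real j))"
    proof (intro sum_mono)
      fix j assume "j \<in> {Suc N..<Suc n}"
      then have "real j * (a j / real j) \<le> real n * (a j / real j)"
        by (intro mult_right_mono divide_nonneg_nonneg nonneg) auto
      then show "a j \<le> real n * (a j / real j)" using \<open>j \<in> {Suc N..<Suc n}\<close> by simp
    qed
    also have "\<dots> = real n * (\<Sum>j\<in>{Suc N..<Suc n}. a j / real j)" by (simp only: sum_distrib_left)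
    also have "\<dots> \<le> real n * (e / 2)"
      using N[of "Suc N" "Suc n"] by (intro mult_left_mono) auto
    finally have "(\<Sum>j=1..n. a j) / real n \<le> ((\<Sum>j=1..N. a j) + real n * (e / 2)) / real n"
      by (intro divide_right_mono) auto
    also have "\<dots> = (\<Sum>j=1..N. a j) / real n + e / 2" using n by (simp add: add_divide_distrib)
    also have "\<dots> < e"
    proof -
      have "N' \<le> n" using n by simp
      from N'[OF this] show ?thesis by linarith
    qed
    finally show "norm ((\<Sum>j=1..n. a j) / real n - 0) < e"
      using sum_nonneg[of "{1..n}" a] nonneg by simp
  qed
qed

lemma (in prob_space) AE_summable:
  fixes f :: "nat \<Rightarrow> 'a \<Rightarrow> real"
  assumes nonneg: "\<And>j \<omega>. 0 \<le> f j \<omega>" and int: "\<And>j. integrable M (f j)"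
    and summ: "summable (\<lambda>j. expectation (f j))"
  shows "AE \<omega> in M. summable (\<lambda>j. f j \<omega>)"
proof -
  have [measurable]: "f j \<in> borel_measurable M" for j using int by simp
  have "(\<integral>\<^sup>+ \<omega>. (\<Sum>j. ennreal (f j \<omega>)) \<partial>M) = (\<Sum>j. \<integral>\<^sup>+ \<omega>. ennreal (f j \<omega>) \<partial>M)"
    by (rule nn_integral_suminf) simp
  also have "\<dots> = (\<Sum>j. ennreal (expectation (f j)))"
    using nonneg int by (intro suminf_cong nn_integral_eq_integral) auto
  also have "\<dots> = ennreal (\<Sum>j. expectation (f j))"
    using nonneg summ by (intro suminf_ennreal2) auto
  finally have "(\<integral>\<^sup>+ \<omega>. (\<Sum>j. ennreal (f j \<omega>)) \<partial>M) \<noteq> \<infinity>" by simp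
  then have "AE \<omega> in M. (\<Sum>j. ennreal (f j \<omega>)) \<noteq> \<infinity>"
    by (intro nn_integral_PInf_AE) auto
  then show ?thesis
    by eventually_elim (use nonneg in \<open>auto intro: summable_suminf_not_top\<close>)
qed

lemma (in prob_space) AE_density_zero:
  fixes B :: "nat \<Rightarrow> 'a set"
  assumes B: "\<And>j. B j \<in> events" and summ: "summable (\<lambda>j. prob (B j) / real j)"
  shows "AE \<omega> in M. (\<lambda>n. real (card {j \<in> {1..n}. \<omega> \<in> B j}) / real n) \<longlonglongrightarrow> 0"
proof -
  have "AE \<omega> in M. summable (\<lambda>j. indicator (B j) \<omega> / real j)"
    using B summ by (intro AE_summable) (auto simp: emeasure_eq_measure)
  then show ?thesis
  proof eventually_elim
    fix \<omega> assume "summable (\<lambda>j. indicator (B j) \<omega> / real j :: real)"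
    then have "(\<lambda>n. (\<Sum>j=1..n. indicator (B j) \<omega>) / real n) \<longlonglongrightarrow> (0 :: real)"
      by (intro Cesaro_mean_tendsto_0) auto
    moreover have "(\<Sum>j=1..n. indicator (B j) \<omega>) = real (card {j \<in> {1..n}. \<omega> \<in> B j})" for n
      by (simp add: indicator_def sum.If_cases Int_def)
    ultimately show "(\<lambda>n. real (card {j \<in> {1..n}. \<omega> \<in> B j}) / real n) \<longlonglongrightarrow> 0" by simp
  qed
qed

text \<open>
  Consecutive fourth powers have a ratio tending to \<open>1\<close>, so a monotone counting function cannot
  lose density between them.
\<close>

lemma mono_density_from_fourth_powers:
  fixes c :: "nat \<Rightarrow> real"
  assumes c: "mono c" "\<And>n. 0 \<le> c n"
    and sub: "\<And>e. 0 < e \<Longrightarrow> \<forall>\<^sub>F k in sequentially. q - e \<le> c (k ^ 4) / real (k ^ 4)"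
    and "0 < e"
  shows "\<forall>\<^sub>F n in sequentially. q - e \<le> c n / real n"
proof -
  have "(\<lambda>k. (q - e / 2) * (real k / (real k + 1)) ^ 4) \<longlonglongrightarrow> (q - e / 2) * 1 ^ 4"
    by (intro tendsto_intros) real_asymp
  then have "\<forall>\<^sub>F k in sequentially. q - e < (q - e / 2) * (real k / (real k + 1)) ^ 4"
    using \<open>0 < e\<close> by (intro order_tendstoD) auto
  with sub[of "e / 2"] \<open>0 < e\<close> eventually_ge_at_top[of 1]
  have "\<forall>\<^sub>F k in sequentially. q - e / 2 \<le> c (k ^ 4) / real (k ^ 4) \<and>
      q - e < (q - e / 2) * (real k / (real k + 1)) ^ 4 \<and> 1 \<le> k"
    by (simp add: eventually_conj_iff)
  then obtain K where K: "\<And>k. K \<le> k \<Longrightarrow> q - e / 2 \<le> c (k ^ 4) / real (k ^ 4) \<and>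
      q - e < (q - e / 2) * (real k / (real k + 1)) ^ 4 \<and> 1 \<le> k"
    unfolding eventually_sequentially by blast
  have "q - e \<le> c n / real n" if n: "K ^ 4 \<le> n" for n
  proof -
    define k where "k = nat \<lfloor>root 4 (real n)\<rfloor>"
    have "real k \<le> root 4 (real n)" "root 4 (real n) \<le> real k + 1"
      by (auto simp: k_def)
    from power_mono[OF this(1), of 4] power_mono[OF this(2), of 4]
    have k: "k ^ 4 \<le> n" "real n \<le> (real k + 1) ^ 4"
      by (simp_all flip: of_nat_power)
    have "real K \<le> root 4 (real n)"
      using n by (metis real_root_le_iff real_root_power_cancel of_nat_0_le_iff of_nat_le_iff of_nat_power zero_less_numeral)
    then have "K \<le> k" unfolding k_def by (simp add: le_nat_iff le_floor_iff)
    note K = K[OF this]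
    have "q - e \<le> c (k ^ 4) / real (k ^ 4) * (real k / (real k + 1)) ^ 4"
    proof -
      have "(q - e / 2) * (real k / (real k + 1)) ^ 4 \<le> c (k ^ 4) / real (k ^ 4) * (real k / (real k + 1)) ^ 4"
        using K by (intro mult_right_mono) auto
      with K show ?thesis by linarith
    qed
    also have "\<dots> = c (k ^ 4) / (real k + 1) ^ 4" using K by (simp add: power_divide)
    also have "\<dots> \<le> c n / real n"
      using k K c monoD[OF c(1) k(1)] less_le_trans[of 0 "k ^ 4" n] by (intro frac_le) auto
    finally show ?thesis .
  qed
  then show ?thesis unfolding eventually_sequentially by blast
qed

text \<open>
  Among the first \<open>k ^ 4\<close> events only pairs at distance at most \<open>k ^ 2\<close> can be correlated, so the
  variance of their number is at most \<open>3 * k ^ 6\<close>.  After division by \<open>k ^ 8\<close> this is summable, which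
  settles the fourth powers; the other times follow by monotonicity.
\<close>

lemma (in prob_space) AE_density_local_dependence:
  fixes G :: "nat \<Rightarrow> 'a set" and h :: "nat \<Rightarrow> nat"
  assumes G: "\<And>j. G j \<in> events"
    and indep: "\<And>i j. 1 \<le> i \<Longrightarrow> i + h j \<le> j \<Longrightarrow> prob (G i \<inter> G j) = prob (G i) * prob (G j)"
    and h: "\<And>j. 1 \<le> j \<Longrightarrow> h j ^ 2 \<le> j"
    and q: "\<And>j. 1 \<le> j \<Longrightarrow> q \<le> prob (G j)"
  shows "AE \<omega> in M. \<forall>e>0. \<forall>\<^sub>F n in sequentially. q - e \<le> real (card {j \<in> {1..n}. \<omega> \<in> G j}) / real n"
proof -
  define Y where "Y j \<omega> = indicator (G j) \<omega> - prob (G j)" for j \<omega>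
  define S where "S n \<omega> = (\<Sum>j=1..n. Y j \<omega>)" for n \<omega>
  have Y_meas[measurable]: "Y j \<in> borel_measurable M" for j unfolding Y_def using G by measurable
  have Y_bound: "\<bar>Y j \<omega>\<bar> \<le> 1" for j \<omega>
    by (auto simp: Y_def split: split_indicator)
  have YY_bound: "\<bar>Y i \<omega> * Y j \<omega>\<bar> \<le> 1" for i j \<omega>
    using mult_mono[OF Y_bound[of i] Y_bound[of j], of \<omega> \<omega>] by (simp add: abs_mult mult.commute)
  have YY_int: "integrable M (\<lambda>\<omega>. Y i \<omega> * Y j \<omega>)" for i j
    using YY_bound by (intro integrable_const_bound[where B = 1]) auto
  have cov: "expectation (\<lambda>\<omega>. Y i \<omega> * Y j \<omega>) = prob (G i \<inter> G j) - prob (G i) * prob (G j)" for i j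
  proof -
    have "Y i \<omega> * Y j \<omega> = indicator (G i \<inter> G j) \<omega> - prob (G j) * indicator (G i) \<omega>
        - prob (G i) * indicator (G j) \<omega> + prob (G i) * prob (G j)" for \<omega>
      by (simp add: Y_def algebra_simps indicator_inter_arith)
    then show ?thesis using G by (simp add: prob_space emeasure_eq_measure)
  qed
  have cov0: "expectation (\<lambda>\<omega>. Y i \<omega> * Y j \<omega>) = 0" if "1 \<le> i" "1 \<le> j" "i + h j \<le> j \<or> j + h i \<le> i" for i j
    using that indep[of i j] indep[of j i] unfolding cov by (auto simp: Int_commute)
  have cov1: "expectation (\<lambda>\<omega>. Y i \<omega> * Y j \<omega>) \<le> 1" for i j
    using integral_mono[OF YY_int, of "\<lambda>_. 1" i j] YY_bound by (auto simp: prob_space abs_le_iff)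
  have S_int: "integrable M (\<lambda>\<omega>. (S n \<omega>)\<^sup>2)" for n
    unfolding S_def power2_eq_square sum_product by (intro Bochner_Integration.integrable_sum YY_int)
  have variance: "expectation (\<lambda>\<omega>. (S (k ^ 4) \<omega>)\<^sup>2) \<le> 3 * real k ^ 6" if "1 \<le> k" for k
  proof -
    have "expectation (\<lambda>\<omega>. (S (k ^ 4) \<omega>)\<^sup>2) = (\<Sum>i=1..k^4. \<Sum>j=1..k^4. expectation (\<lambda>\<omega>. Y i \<omega> * Y j \<omega>))"
      unfolding S_def power2_eq_square sum_product
      by (simp only: Bochner_Integration.integral_sum Bochner_Integration.integrable_sum YY_int)
    also have "\<dots> \<le> (\<Sum>i=1..k^4. \<Sum>j=1..k^4. if j \<in> {i - k^2..i + k^2} then 1 else 0)"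
    proof (intro sum_mono)
      fix i j assume ij: "i \<in> {1..k^4}" "j \<in> {1..k^4}"
      have hk: "h j \<le> k^2" if "j \<in> {1..k^4}" for j
      proof (rule power2_le_imp_le)
        show "(h j)\<^sup>2 \<le> (k\<^sup>2)\<^sup>2" using h[of j] that by (simp flip: power_mult)
      qed simp
      have "i + h j \<le> j \<or> j + h i \<le> i" if "j \<notin> {i - k^2..i + k^2}"
        using that hk[OF ij(1)] hk[OF ij(2)] by auto
      then show "expectation (\<lambda>\<omega>. Y i \<omega> * Y j \<omega>) \<le> (if j \<in> {i - k^2..i + k^2} then 1 else 0)"
        using cov0[of i j] cov1[of i j] ij by auto
    qed
    also have "\<dots> \<le> (\<Sum>i=1..k^4. 3 * real (k^2))"
    proof (intro sum_mono)
      fix i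
      have "(\<Sum>j=1..k^4. if j \<in> {i - k^2..i + k^2} then 1 else 0 :: real) = real (card ({1..k^4} \<inter> {i - k^2..i + k^2}))"
        by (simp only: sum.inter_restrict[symmetric, OF finite_atLeastAtMost]) simp
      also have "\<dots> \<le> real (card {i - k^2..i + k^2})"
        by (intro of_nat_mono card_mono) auto
      also have "\<dots> \<le> 3 * real (k^2)"
      proof -
        have "1 \<le> k^2" using that by simp
        then have "card {i - k^2..i + k^2} \<le> 3 * k^2" by simp
        then show ?thesis by (metis of_nat_le_iff of_nat_mult of_nat_numeral)
      qed
      finally show "(\<Sum>j=1..k^4. if j \<in> {i - k^2..i + k^2} then 1 else 0 :: real) \<le> 3 * real (k^2)" .
    qed
    also have "\<dots> = 3 * real k ^ 6" by (simp flip: power_add)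
    finally show ?thesis .
  qed
  have "AE \<omega> in M. summable (\<lambda>k. (S (k ^ 4) \<omega>)\<^sup>2 / (real k ^ 4)\<^sup>2)"
  proof (rule AE_summable)
    have "summable (\<lambda>k. 3 * (1 / real k ^ 2))"
      by (intro summable_mult inverse_power_summable[of 2, unfolded inverse_eq_divide]) simp
    then show "summable (\<lambda>k. expectation (\<lambda>\<omega>. (S (k ^ 4) \<omega>)\<^sup>2 / (real k ^ 4)\<^sup>2))"
    proof (rule summable_comparison_test_ev[rotated], intro eventually_mono[OF eventually_ge_at_top[of 1]])
      fix k :: nat assume k: "1 \<le> k"
      have "expectation (\<lambda>\<omega>. (S (k ^ 4) \<omega>)\<^sup>2 / (real k ^ 4)\<^sup>2) = expectation (\<lambda>\<omega>. (S (k ^ 4) \<omega>)\<^sup>2) / real k ^ 8"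
        by (simp flip: power_mult)
      also have "\<dots> \<le> 3 * real k ^ 6 / real k ^ 8"
        by (intro divide_right_mono variance k) auto
      also have "\<dots> = 3 * (1 / real k ^ 2)" using k by (simp add: power_numeral_reduce)
      finally show "norm (expectation (\<lambda>\<omega>. (S (k ^ 4) \<omega>)\<^sup>2 / (real k ^ 4)\<^sup>2)) \<le> 3 * (1 / real k ^ 2)"
        by (simp add: integral_nonneg_AE)
    qed
  qed (use S_int in auto)
  then show ?thesis
  proof eventually_elim
    fix \<omega> assume "summable (\<lambda>k. (S (k ^ 4) \<omega>)\<^sup>2 / (real k ^ 4)\<^sup>2)"
    then have "(\<lambda>k. (S (k ^ 4) \<omega> / real k ^ 4)\<^sup>2) \<longlonglongrightarrow> 0"
      by (simp add: summable_LIMSEQ_zero power_divide)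
    then have lim: "(\<lambda>k. S (k ^ 4) \<omega> / real k ^ 4) \<longlonglongrightarrow> 0"
      by (simp add: power_tendsto_0_iff)
    let ?c = "\<lambda>n. real (card {j \<in> {1..n}. \<omega> \<in> G j})"
    have c: "?c n = S n \<omega> + (\<Sum>j=1..n. prob (G j))" for n
      by (simp add: S_def Y_def sum_subtractf indicator_def sum.If_cases Int_def)
    show "\<forall>e>0. \<forall>\<^sub>F n in sequentially. q - e \<le> ?c n / real n"
    proof (intro allI impI)
      fix e :: real assume "0 < e"
      show "\<forall>\<^sub>F n in sequentially. q - e \<le> ?c n / real n"
      proof (rule mono_density_from_fourth_powers[OF _ _ _ \<open>0 < e\<close>])
        show "mono ?c" by (intro monoI of_nat_mono card_mono) auto
        fix e :: real assume "0 < e"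
        with lim have "\<forall>\<^sub>F k in sequentially. - e < S (k ^ 4) \<omega> / real k ^ 4"
          by (intro order_tendstoD) auto
        then show "\<forall>\<^sub>F k in sequentially. q - e \<le> ?c (k ^ 4) / real (k ^ 4)"
          using eventually_ge_at_top[of 1]
        proof eventually_elim
          fix k :: nat assume *: "- e < S (k ^ 4) \<omega> / real k ^ 4" "1 \<le> k"
          have "real (k ^ 4) * q \<le> (\<Sum>j=1..k^4. prob (G j))"
            using sum_mono[of "{1..k^4}" "\<lambda>_. q" "\<lambda>j. prob (G j)"] q by simp
          then have "q \<le> (\<Sum>j=1..k^4. prob (G j)) / real (k ^ 4)"
            using * by (simp add: pos_le_divide_eq mult.commute)
          with * show "q - e \<le> ?c (k ^ 4) / real (k ^ 4)"
            unfolding c by (simp add: add_divide_distrib)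
        qed
      qed auto
    qed
  qed
qed

section \<open>The excited walk between coin times\<close>

context pn_ERW
begin

sublocale lattice_walk M \<xi>
proof
  show "indep_vars (\<lambda>_. count_space UNIV) \<xi> {1..}" by (rule \<xi>_indep)
  show "distr M (count_space UNIV) (\<xi> i) = distr M (count_space UNIV) (\<xi> 1)" if "i \<ge> 1" for i
    using that by (rule \<xi>_ident)
  show "expectation (\<lambda>\<omega>. real_vec (\<xi> 1 \<omega>)) = 0" by (rule \<xi>_mean) simp
  show "\<P>(\<omega> in M. real_vec (\<xi> 1 \<omega>) \<bullet> u = 0) < 1" if "norm u = 1" for u
    using that by (intro \<xi>_nondegenerate) auto
  obtain K where K: "\<And>\<omega>. \<omega> \<in> space M \<Longrightarrow> norm (real_vec (\<xi> 1 \<omega>)) \<le> K"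
    using bounded by auto
  have "\<xi> 1 \<in> M \<rightarrow>\<^sub>M count_space UNIV" using \<xi>_indep by (auto simp: indep_vars_def)
  then have "(\<lambda>\<omega>. real_vec (\<xi> 1 \<omega>)) \<in> borel_measurable M"
    by (rule measurable_compose) simp
  then show "integrable M (\<lambda>\<omega>. real_vec (\<xi> 1 \<omega>))"
    using K by (intro integrable_const_bound[where B = K]) auto
qed

lemma \<gamma>_measurable: "1 \<le> i \<Longrightarrow> \<gamma> i \<in> M \<rightarrow>\<^sub>M count_space UNIV"
  using \<gamma>_indep by (auto simp: indep_vars_def)

lemma U_measurable: "1 \<le> i \<Longrightarrow> U i \<in> borel_measurable M"
  using U_iid by (auto simp: indep_vars_def)

lemma prob_coin:
  assumes "1 \<le> i"
  shows "\<P>(\<omega> in M. U i \<omega> \<le> p i) = p i"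
proof -
  have "\<P>(\<omega> in M. U i \<omega> \<le> p i) = measure (distr M borel (U i)) {..p i}"
    using U_measurable[OF assms] by (subst measure_distr) (auto intro!: arg_cong[where f = prob])
  also have "\<dots> = measure lborel ({0..1} \<inter> {..p i}) / measure lborel {0..1::real}"
    unfolding U_uniform[OF assms] by (subst measure_uniform_measure) auto
  also have "{0..1} \<inter> {..p i} = {0..p i}" using p_range[OF assms] by auto
  finally show ?thesis using p_range[OF assms] by simp
qed

lemma X_Suc:
  assumes "\<omega> \<in> space M"
  shows "X (Suc n) \<omega> = X n \<omega> +
    (if \<omega> \<in> revisit X n \<or> p (Suc n) < U (Suc n) \<omega> then \<xi> (Suc n) \<omega> else \<gamma> (Suc n) \<omega>)"
proof -
  have "X (Suc n) \<omega> = X n \<omega> +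
      (indicator (revisit X n) \<omega> *s \<xi> (Suc n) \<omega>
       + indicator (- revisit X n \<inter> {\<omega>. U (Suc n) \<omega> > p (Suc n)}) \<omega> *s \<xi> (Suc n) \<omega>
       + indicator (- revisit X n \<inter> {\<omega>. U (Suc n) \<omega> \<le> p (Suc n)}) \<omega> *s \<gamma> (Suc n) \<omega>)"
    using walk[OF assms, of "Suc n"] walk[OF assms, of n] by simp
  then show ?thesis by (auto simp: indicator_def)
qed

lemma X_eq_incr:
  assumes "\<omega> \<in> space M" "\<And>i. i \<in> {s<..t} \<Longrightarrow> p i < U i \<omega>" "s \<le> k" "k \<le> t"
  shows "X t \<omega> = X k \<omega> + incr k t \<omega>"
  using assms(4,2)
proof (induction t rule: dec_induct)
  case base
  then show ?case by (simp add: incr_def)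
next
  case (step n)
  have "{k<..Suc n} = insert (Suc n) {k<..n}" using step.hyps by auto
  then have "incr k (Suc n) \<omega> = \<xi> (Suc n) \<omega> + incr k n \<omega>" by (simp add: incr_def)
  moreover have "X n \<omega> = X k \<omega> + incr k n \<omega>" using step.IH step.prems by auto
  moreover have "p (Suc n) < U (Suc n) \<omega>" using step.prems step.hyps \<open>s \<le> k\<close> by auto
  ultimately show ?case by (simp add: X_Suc[OF assms(1)])
qed

text \<open>
  A deterministic criterion: the last two hypotheses exclude the sites visited up to time \<open>s\<close> and
  those visited since then.
\<close>

lemma new_site_if:
  assumes "\<omega> \<in> space M" "\<And>i. i \<in> {s<..t} \<Longrightarrow> p i < U i \<omega>" "s \<le> t"
    and old: "\<And>k. k \<le> s \<Longrightarrow> X k \<omega> - X s \<omega> \<noteq> incr s t \<omega>"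
    and recent: "\<And>k. k \<in> {s..<t} \<Longrightarrow> incr k t \<omega> \<noteq> 0"
  shows "\<omega> \<notin> revisit X t"
proof
  assume "\<omega> \<in> revisit X t"
  then obtain k where k: "k < t" "X k \<omega> = X t \<omega>" by (auto simp: revisit_def)
  show False
  proof (cases "k \<le> s")
    case True
    have "X t \<omega> = X s \<omega> + incr s t \<omega>"
      by (rule X_eq_incr[OF assms(1)]) (use assms(2,3) in auto)
    with old[OF True] k show False by simp
  next
    case False
    have "X t \<omega> = X k \<omega> + incr k t \<omega>"
      by (rule X_eq_incr[OF assms(1)]) (use assms(2) False k in auto)
    with recent[of k] k False show False by simp
  qed
qed

lemma card_new_sites_le_range: "card {t \<in> {1..n}. \<omega> \<notin> revisit X t} \<le> card (walk_range X n \<omega>)"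
proof -
  have "inj_on (\<lambda>t. X t \<omega>) {t \<in> {1..n}. \<omega> \<notin> revisit X t}"
    by (rule linorder_inj_onI) (auto simp: revisit_def)
  then show ?thesis
    by (rule card_inj_on_le) (auto simp: walk_range_def)
qed

text \<open>
  All the randomness that enters \<open>X 0, \<dots>, X s\<close>.  Recording only the outcomes of the coins instead of
  the variables \<open>U i\<close> makes this a random variable with countably many values, so that conditioning
  on the past reduces to summing over the values of the history.
\<close>

definition hist :: "nat \<Rightarrow> 'a \<Rightarrow> ((int ^ 'd) \<times> (int ^ 'd) \<times> bool) list" where
  "hist s \<omega> = map (\<lambda>i. (\<xi> i \<omega>, \<gamma> i \<omega>, U i \<omega> \<le> p i)) [1..<Suc s]"

lemma hist_eq_iff:
  "hist s \<omega> = a \<longleftrightarrow> length a = s \<and>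
     (\<forall>i\<in>{1..s}. \<xi> i \<omega> = fst (a ! (i - 1))) \<and> (\<forall>i\<in>{1..s}. \<gamma> i \<omega> = fst (snd (a ! (i - 1)))) \<and>
     (\<forall>i\<in>{1..s}. (U i \<omega> \<le> p i) = snd (snd (a ! (i - 1))))"
proof -
  have "hist s \<omega> = a \<longleftrightarrow> length a = s \<and> (\<forall>j<s. (\<xi> (Suc j) \<omega>, \<gamma> (Suc j) \<omega>, U (Suc j) \<omega> \<le> p (Suc j)) = a ! j)"
    by (auto simp: hist_def list_eq_iff_nth_eq simp del: upt_Suc)
  also have "\<dots> \<longleftrightarrow> length a = s \<and> (\<forall>i\<in>{1..s}. (\<xi> i \<omega>, \<gamma> i \<omega>, U i \<omega> \<le> p i) = a ! (i - 1))"
  proof -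
    have "{1..s} = Suc ` {..<s}" by (simp add: image_Suc_lessThan)
    then show ?thesis by auto
  qed
  finally show ?thesis by (auto simp: prod_eq_iff)
qed

lemma hist_determines_X:
  assumes "\<omega> \<in> space M" "\<omega>' \<in> space M" "hist s \<omega> = hist s \<omega>'" "k \<le> s"
  shows "X k \<omega> = X k \<omega>'"
proof -
  have eq: "\<xi> i \<omega> = \<xi> i \<omega>'" "\<gamma> i \<omega> = \<gamma> i \<omega>'" "U i \<omega> \<le> p i \<longleftrightarrow> U i \<omega>' \<le> p i" if "1 \<le> i" "i \<le> s" for i
    using assms(3) that by (auto simp: hist_def simp del: upt_Suc)
  have "\<forall>j\<le>k. X j \<omega> = X j \<omega>'"
    using assms(4)
  proof (induction k)
    case 0
    then show ?case using walk[OF assms(1), of 0] walk[OF assms(2), of 0] by simp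
  next
    case (Suc k)
    then have IH: "\<And>j. j \<le> k \<Longrightarrow> X j \<omega> = X j \<omega>'" by simp
    have "\<omega> \<in> revisit X k \<longleftrightarrow> \<omega>' \<in> revisit X k" by (auto simp: revisit_def IH)
    then have "X (Suc k) \<omega> = X (Suc k) \<omega>'"
      using eq[of "Suc k"] IH[of k] Suc.prems
      unfolding X_Suc[OF assms(1)] X_Suc[OF assms(2)] by (auto simp: not_le)
    with IH show ?case by (auto simp: le_Suc_eq)
  qed
  then show ?thesis by simp
qed

text \<open>
  The variables \<open>U\<close> are separated from the pair \<open>(\<xi>, \<gamma>)\<close> first, and then \<open>\<xi>\<close> from \<open>\<gamma>\<close>; the events on
  both sides are cylinders over finitely many coordinates.
\<close>

lemma joint_indep:
  "\<P>(\<omega> in M. Q (\<lambda>i\<in>{1..t}. \<xi> i \<omega>) \<and> R (\<lambda>i\<in>{1..t}. \<gamma> i \<omega>) \<and> (\<forall>i\<in>{1..s}. (U i \<omega> \<le> p i) = b i)) =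
   \<P>(\<omega> in M. Q (\<lambda>i\<in>{1..t}. \<xi> i \<omega>)) * \<P>(\<omega> in M. R (\<lambda>i\<in>{1..t}. \<gamma> i \<omega>)) *
   \<P>(\<omega> in M. \<forall>i\<in>{1..s}. (U i \<omega> \<le> p i) = b i)"
proof -
  let ?L = "\<Pi>\<^sub>M i\<in>{1::nat..}. count_space (UNIV :: (int ^ 'd) set)"
  have cyl: "{x \<in> space ?L. Q (restrict x {1..t})} \<in> sets ?L" for Q
  proof -
    have "(\<lambda>x. restrict x {1..t}) \<in> ?L \<rightarrow>\<^sub>M (\<Pi>\<^sub>M i\<in>{1..t}. count_space UNIV)"
      by (rule measurable_restrict_subset) auto
    then have "(\<lambda>x. restrict x {1..t}) \<in> ?L \<rightarrow>\<^sub>M count_space (Pi\<^sub>E {1..t} (\<lambda>_. UNIV))"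
      by (simp add: PiM_count_space)
    moreover have "Measurable.pred (count_space (Pi\<^sub>E {1..t} (\<lambda>_. UNIV))) Q" by simp
    ultimately show ?thesis by measurable
  qed
  let ?R = "\<Pi>\<^sub>M i\<in>{1::nat..}. (borel :: real measure)"
  have C: "{x \<in> space ?R. \<forall>i\<in>{1..s}. (x i \<le> p i) = b i} \<in> sets ?R"
  proof (intro sets.sets_Collect_finite_All)
    fix i assume i: "i \<in> {1..s}"
    have "(\<lambda>x. x i) \<in> ?R \<rightarrow>\<^sub>M borel" using i by (intro measurable_component_singleton) auto
    then show "{x \<in> space ?R. (x i \<le> p i) = b i} \<in> sets ?R" by measurable
  next
    show "finite {1..s}" by simp
  qed
  let ?A = "{x \<in> space ?L. Q (restrict x {1..t})}" and ?B = "{x \<in> space ?L. R (restrict x {1..t})}"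
    and ?C = "{x \<in> space ?R. \<forall>i\<in>{1..s}. (x i \<le> p i) = b i}"
  let ?x = "\<lambda>\<omega>. \<lambda>i\<in>{1..}. \<xi> i \<omega>" and ?g = "\<lambda>\<omega>. \<lambda>i\<in>{1..}. \<gamma> i \<omega>" and ?u = "\<lambda>\<omega>. \<lambda>i\<in>{1..}. U i \<omega>"
  have r: "restrict (restrict f {1..}) {1..t} = restrict f {1..t}" for f :: "nat \<Rightarrow> int ^ 'd"
    by (auto simp: restrict_def)
  have vx: "?x -` ?A \<inter> space M = {\<omega> \<in> space M. Q (\<lambda>i\<in>{1..t}. \<xi> i \<omega>)}"
    and vg: "?g -` ?B \<inter> space M = {\<omega> \<in> space M. R (\<lambda>i\<in>{1..t}. \<gamma> i \<omega>)}"
    and vxg: "(\<lambda>\<omega>. (?x \<omega>, ?g \<omega>)) -` (?A \<times> ?B) \<inter> space M =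
        {\<omega> \<in> space M. Q (\<lambda>i\<in>{1..t}. \<xi> i \<omega>) \<and> R (\<lambda>i\<in>{1..t}. \<gamma> i \<omega>)}"
    by (auto simp: space_PiM r)
  have vu: "?u -` ?C \<inter> space M = {\<omega> \<in> space M. \<forall>i\<in>{1..s}. (U i \<omega> \<le> p i) = b i}"
    by (auto simp: space_PiM)
  have "prob (((\<lambda>\<omega>. (?x \<omega>, ?g \<omega>)) -` (?A \<times> ?B) \<inter> space M) \<inter> (?u -` ?C \<inter> space M)) =
      prob ((\<lambda>\<omega>. (?x \<omega>, ?g \<omega>)) -` (?A \<times> ?B) \<inter> space M) * prob (?u -` ?C \<inter> space M)"
  proof (rule indep_setD[OF U_indep])
    show "(\<lambda>\<omega>. (?x \<omega>, ?g \<omega>)) -` (?A \<times> ?B) \<inter> space M \<in>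
        {(\<lambda>\<omega>. (?x \<omega>, ?g \<omega>)) -` A \<inter> space M | A. A \<in> sets (?L \<Otimes>\<^sub>M ?L)}"
      by (rule CollectI, rule exI[of _ "?A \<times> ?B"], intro conjI refl pair_measureI cyl)
    show "?u -` ?C \<inter> space M \<in> {?u -` B \<inter> space M | B. B \<in> sets ?R}"
      by (rule CollectI, rule exI[of _ ?C], intro conjI refl C)
  qed
  also have "prob ((\<lambda>\<omega>. (?x \<omega>, ?g \<omega>)) -` (?A \<times> ?B) \<inter> space M) =
      prob (?x -` ?A \<inter> space M) * prob (?g -` ?B \<inter> space M)"
    by (rule indep_varD[OF \<xi>_\<gamma>_indep cyl cyl])
  finally have "prob (((\<lambda>\<omega>. (?x \<omega>, ?g \<omega>)) -` (?A \<times> ?B) \<inter> space M) \<inter> (?u -` ?C \<inter> space M)) =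
      prob (?x -` ?A \<inter> space M) * prob (?g -` ?B \<inter> space M) * prob (?u -` ?C \<inter> space M)" .
  moreover have "((\<lambda>\<omega>. (?x \<omega>, ?g \<omega>)) -` (?A \<times> ?B) \<inter> space M) \<inter> (?u -` ?C \<inter> space M) =
      {\<omega> \<in> space M. Q (\<lambda>i\<in>{1..t}. \<xi> i \<omega>) \<and> R (\<lambda>i\<in>{1..t}. \<gamma> i \<omega>) \<and> (\<forall>i\<in>{1..s}. (U i \<omega> \<le> p i) = b i)}"
    unfolding vxg vu by blast
  ultimately show ?thesis unfolding vx vg vu by simp
qed

lemma hist_event: "{\<omega> \<in> space M. hist s \<omega> = a} \<in> events"
proof -
  have "{\<omega> \<in> space M. \<xi> i \<omega> = x} \<in> events" "{\<omega> \<in> space M. \<gamma> i \<omega> = x} \<in> events"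
    "{\<omega> \<in> space M. (U i \<omega> \<le> p i) = y} \<in> events" if "i \<in> {1..s}" for i x y
    using that step_measurable[of i] \<gamma>_measurable[of i] U_measurable[of i] by (measurable; simp)+
  then show ?thesis
    unfolding hist_eq_iff by (intro sets.sets_Collect_conj sets.sets_Collect_const sets.sets_Collect_finite_All) auto
qed

lemma hist_indep_incr:
  assumes "s \<le> t"
  shows "\<P>(\<omega> in M. hist s \<omega> = a \<and> incr s t \<omega> = w) = \<P>(\<omega> in M. hist s \<omega> = a) * \<P>(\<omega> in M. incr s t \<omega> = w)"
proof (cases "length a = s")
  case False
  then show ?thesis by (simp add: hist_eq_iff)
next
  case True
  let ?Q = "\<lambda>x. \<forall>i\<in>{1..s}. x i = fst (a ! (i - 1))"
  let ?R = "\<lambda>x. \<forall>i\<in>{1..s}. x i = fst (snd (a ! (i - 1)))"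
  let ?W = "\<lambda>x. (\<Sum>i\<in>{s<..t}. x i) = w"
  have [simp]: "?Q (restrict x {1..n}) \<longleftrightarrow> ?Q x" "?R (restrict x {1..n}) \<longleftrightarrow> ?R x" if "s \<le> n" for n and x :: "nat \<Rightarrow> int ^ 'd"
    using that by auto
  have "{s<..t} \<subseteq> {1..t}" by auto
  note W = incr_eq_restrict[OF this] incr_eq_restrict[OF subset_refl]
  let ?H = "\<lambda>\<omega>. \<forall>i\<in>{1..s}. (U i \<omega> \<le> p i) = snd (snd (a ! (i - 1)))"
  have "\<P>(\<omega> in M. hist s \<omega> = a \<and> incr s t \<omega> = w) =
      \<P>(\<omega> in M. ?Q (\<lambda>i\<in>{1..t}. \<xi> i \<omega>) \<and> ?W (\<lambda>i\<in>{1..t}. \<xi> i \<omega>)) *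
      \<P>(\<omega> in M. ?R (\<lambda>i\<in>{1..t}. \<gamma> i \<omega>)) * \<P>(\<omega> in M. ?H \<omega>)"
    unfolding joint_indep[where Q = "\<lambda>x. ?Q x \<and> ?W x" and R = ?R, symmetric]
    using assms True by (intro arg_cong[where f = prob]) (auto simp: hist_eq_iff W(1))
  also have "\<P>(\<omega> in M. ?Q (\<lambda>i\<in>{1..t}. \<xi> i \<omega>) \<and> ?W (\<lambda>i\<in>{1..t}. \<xi> i \<omega>)) =
      \<P>(\<omega> in M. ?Q (\<lambda>i\<in>{1..s}. \<xi> i \<omega>) \<and> ?W (\<lambda>i\<in>{s<..t}. \<xi> i \<omega>))"
    using assms by (intro arg_cong[where f = prob]) (auto simp flip: W)
  also have "\<dots> = \<P>(\<omega> in M. ?Q (\<lambda>i\<in>{1..s}. \<xi> i \<omega>)) * \<P>(\<omega> in M. ?W (\<lambda>i\<in>{s<..t}. \<xi> i \<omega>))"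
    by (rule disjoint_blocks_indep) auto
  also have "\<P>(\<omega> in M. ?Q (\<lambda>i\<in>{1..s}. \<xi> i \<omega>)) = \<P>(\<omega> in M. ?Q (\<lambda>i\<in>{1..t}. \<xi> i \<omega>))"
    using assms by (intro arg_cong[where f = prob]) auto
  also have "\<P>(\<omega> in M. ?W (\<lambda>i\<in>{s<..t}. \<xi> i \<omega>)) = \<P>(\<omega> in M. incr s t \<omega> = w)"
    by (simp only: W(2))
  finally have "\<P>(\<omega> in M. hist s \<omega> = a \<and> incr s t \<omega> = w) =
      \<P>(\<omega> in M. ?Q (\<lambda>i\<in>{1..t}. \<xi> i \<omega>)) * \<P>(\<omega> in M. ?R (\<lambda>i\<in>{1..t}. \<gamma> i \<omega>)) * \<P>(\<omega> in M. ?H \<omega>) *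
      \<P>(\<omega> in M. incr s t \<omega> = w)"
    by (simp only: mult_ac)
  also have "\<P>(\<omega> in M. ?Q (\<lambda>i\<in>{1..t}. \<xi> i \<omega>)) * \<P>(\<omega> in M. ?R (\<lambda>i\<in>{1..t}. \<gamma> i \<omega>)) * \<P>(\<omega> in M. ?H \<omega>) =
      \<P>(\<omega> in M. hist s \<omega> = a)"
    unfolding joint_indep[where Q = ?Q and R = ?R, symmetric]
    using assms True by (intro arg_cong[where f = prob]) (auto simp: hist_eq_iff)
  finally show ?thesis .
qed

text \<open>
  On each value of the history the sites \<open>X 0, \<dots>, X s\<close> are fixed, and the increment after time \<open>s\<close> is
  independent of the history.  A union bound over the \<open>s + 1\<close> sites, summed over all histories,
  gives the estimate.
\<close>

lemma hit_past_prob: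
  assumes "s \<le> t" and B: "\<And>z. \<P>(\<omega> in M. incr s t \<omega> = z) \<le> B"
  shows "{\<omega> \<in> space M. \<exists>k\<le>s. X k \<omega> - X s \<omega> = incr s t \<omega>} \<in> events" (is "?E \<in> _")
    and "\<P>(\<omega> in M. \<exists>k\<le>s. X k \<omega> - X s \<omega> = incr s t \<omega>) \<le> (real s + 1) * B"
proof -
  have B0: "0 \<le> B" using order_trans[OF measure_nonneg B] .
  let ?F = "\<lambda>a. {\<omega> \<in> ?E. hist s \<omega> = a}"
  have UN: "?E = (\<Union>a. ?F a)" by auto
  have F: "?F a \<in> events \<and> emeasure M (?F a) \<le> ennreal ((real s + 1) * B) * emeasure M {\<omega> \<in> space M. hist s \<omega> = a}" for a
  proof (cases "\<exists>\<omega>\<in>space M. hist s \<omega> = a")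
    case False
    then have empty: "?F a = {}" by auto
    show ?thesis unfolding empty by simp
  next
    case True
    then obtain \<omega>' where \<omega>': "\<omega>' \<in> space M" "hist s \<omega>' = a" by auto
    let ?D = "\<lambda>k. {\<omega> \<in> space M. hist s \<omega> = a \<and> incr s t \<omega> = X k \<omega>' - X s \<omega>'}"
    have X_eq: "X k \<omega> = X k \<omega>'" if "\<omega> \<in> space M" "hist s \<omega> = a" "k \<le> s" for \<omega> k
      using that \<omega>' by (intro hist_determines_X[where s = s]) auto
    have eq: "?F a = (\<Union>k\<in>{..s}. ?D k)"
    proof (intro set_eqI iffI)
      fix \<omega> assume "\<omega> \<in> ?F a"
      then obtain k where "\<omega> \<in> space M" "hist s \<omega> = a" "k \<le> s" "X k \<omega> - X s \<omega> = incr s t \<omega>" by blast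
      then show "\<omega> \<in> (\<Union>k\<in>{..s}. ?D k)"
        using X_eq[of \<omega> k] X_eq[of \<omega> s] by (intro UN_I[of k]) auto
    next
      fix \<omega> assume "\<omega> \<in> (\<Union>k\<in>{..s}. ?D k)"
      then obtain k where "\<omega> \<in> space M" "hist s \<omega> = a" "k \<le> s" "incr s t \<omega> = X k \<omega>' - X s \<omega>'" by blast
      then show "\<omega> \<in> ?F a" using X_eq[of \<omega> k] X_eq[of \<omega> s] by auto
    qed
    have ev: "?D k \<in> events" for k
    proof -
      have "?D k = {\<omega> \<in> space M. hist s \<omega> = a} \<inter> {\<omega> \<in> space M. incr s t \<omega> = X k \<omega>' - X s \<omega>'}" by auto
      then show ?thesis using hist_event incr_event by auto
    qed
    have "prob (?F a) \<le> (\<Sum>k\<in>{..s}. prob (?D k))"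
      unfolding eq using ev by (intro finite_measure_subadditive_finite) auto
    also have "\<dots> \<le> (\<Sum>k\<in>{..s}. \<P>(\<omega> in M. hist s \<omega> = a) * B)"
      unfolding hist_indep_incr[OF assms(1)] by (intro sum_mono mult_left_mono B) auto
    finally have "prob (?F a) \<le> (real s + 1) * B * \<P>(\<omega> in M. hist s \<omega> = a)" by (simp add: algebra_simps)
    moreover have "?F a \<in> events" unfolding eq using ev by auto
    ultimately show ?thesis
      using B0 unfolding emeasure_eq_measure
      by (subst ennreal_mult'[symmetric]) (simp_all only: ennreal_leI add_nonneg_nonneg mult_nonneg_nonneg
          of_nat_0_le_iff zero_le_one simp_thms)
  qed
  have "(\<Union>a. ?F a) \<in> events"
    by (rule sets.countable_UN'[OF countableI_type]) (rule image_subsetI, rule conjunct1[OF F])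
  then show "?E \<in> events" by (rule ssubst[OF UN])
  have "emeasure M ?E = emeasure M (\<Union>a. ?F a)" using UN by (rule arg_cong)
  also have "\<dots> = (\<integral>\<^sup>+ a. emeasure M (?F a) \<partial>count_space UNIV)"
    by (rule emeasure_UN_countable[OF conjunct1[OF F] countableI_type]) (auto simp: disjoint_family_on_def)
  also have "\<dots> \<le> (\<integral>\<^sup>+ a. ennreal ((real s + 1) * B) * emeasure M {\<omega> \<in> space M. hist s \<omega> = a} \<partial>count_space UNIV)"
    by (intro nn_integral_mono conjunct2[OF F])
  also have "\<dots> = ennreal ((real s + 1) * B) * (\<integral>\<^sup>+ a. emeasure M {\<omega> \<in> space M. hist s \<omega> = a} \<partial>count_space UNIV)"
    by (rule nn_integral_cmult) auto
  also have "(\<integral>\<^sup>+ a. emeasure M {\<omega> \<in> space M. hist s \<omega> = a} \<partial>count_space UNIV) = emeasure M (\<Union>a. {\<omega> \<in> space M. hist s \<omega> = a})"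
    by (rule emeasure_UN_countable[symmetric]) (auto simp: disjoint_family_on_def hist_event)
  also have "(\<Union>a. {\<omega> \<in> space M. hist s \<omega> = a}) = space M" by auto
  finally show "prob ?E \<le> (real s + 1) * B"
    using B0 by (simp add: emeasure_eq_measure prob_space)
qed

lemma coin_window_prob:
  shows "{\<omega> \<in> space M. \<exists>i\<in>{s<..t}. U i \<omega> \<le> p i} \<in> events"
    and "\<P>(\<omega> in M. \<exists>i\<in>{s<..t}. U i \<omega> \<le> p i) \<le> (\<Sum>i\<in>{s<..t}. p i)"
proof -
  have UN: "{\<omega> \<in> space M. \<exists>i\<in>{s<..t}. U i \<omega> \<le> p i} = (\<Union>i\<in>{s<..t}. {\<omega> \<in> space M. U i \<omega> \<le> p i})" by auto
  have ev: "{\<omega> \<in> space M. U i \<omega> \<le> p i} \<in> events" if "i \<in> {s<..t}" for i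
    using that U_measurable[of i] by (measurable; simp)
  show "{\<omega> \<in> space M. \<exists>i\<in>{s<..t}. U i \<omega> \<le> p i} \<in> events"
    unfolding UN using ev by auto
  have "\<P>(\<omega> in M. \<exists>i\<in>{s<..t}. U i \<omega> \<le> p i) \<le> (\<Sum>i\<in>{s<..t}. \<P>(\<omega> in M. U i \<omega> \<le> p i))"
    unfolding UN using ev by (intro finite_measure_subadditive_finite) auto
  also have "\<dots> = (\<Sum>i\<in>{s<..t}. p i)" by (intro sum.cong prob_coin) auto
  finally show "\<P>(\<omega> in M. \<exists>i\<in>{s<..t}. U i \<omega> \<le> p i) \<le> (\<Sum>i\<in>{s<..t}. p i)" .
qed

lemma recent_event:
  "{\<omega> \<in> space M. \<forall>k\<in>{s..<t}. incr k t \<omega> \<noteq> 0} \<in> events"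
  by (intro sets.sets_Collect_finite_All incr_event) auto

lemma recent_indep:
  assumes "i \<le> s"
  shows "prob ({\<omega> \<in> space M. \<forall>k\<in>{r..<i}. incr k i \<omega> \<noteq> 0} \<inter> {\<omega> \<in> space M. \<forall>k\<in>{s..<t}. incr k t \<omega> \<noteq> 0}) =
    \<P>(\<omega> in M. \<forall>k\<in>{r..<i}. incr k i \<omega> \<noteq> 0) * \<P>(\<omega> in M. \<forall>k\<in>{s..<t}. incr k t \<omega> \<noteq> 0)"
proof -
  have local: "(\<forall>k\<in>{s..<t}. incr k t \<omega> \<noteq> 0) \<longleftrightarrow> (\<forall>k\<in>{s..<t}. (\<Sum>i\<in>{k<..t}. (\<lambda>i\<in>{s<..t}. \<xi> i \<omega>) i) \<noteq> 0)" for s t \<omega>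
    by (intro ball_cong refl arg_cong[where f = Not] arg_cong2[where f = "(=)"] incr_eq_restrict) auto
  have "\<P>(\<omega> in M. (\<forall>k\<in>{r..<i}. incr k i \<omega> \<noteq> 0) \<and> (\<forall>k\<in>{s..<t}. incr k t \<omega> \<noteq> 0)) =
    \<P>(\<omega> in M. \<forall>k\<in>{r..<i}. incr k i \<omega> \<noteq> 0) * \<P>(\<omega> in M. \<forall>k\<in>{s..<t}. incr k t \<omega> \<noteq> 0)"
    unfolding local[of r i] local[of s t]
    using assms by (intro disjoint_blocks_indep[where A = "{r<..i}" and B = "{s<..t}"
          and P = "\<lambda>x. \<forall>k\<in>{r..<i}. (\<Sum>j\<in>{k<..i}. x j) \<noteq> 0" and Q = "\<lambda>x. \<forall>k\<in>{s..<t}. (\<Sum>j\<in>{k<..t}. x j) \<noteq> 0"]) auto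
  moreover have "{\<omega> \<in> space M. \<forall>k\<in>{r..<i}. incr k i \<omega> \<noteq> 0} \<inter> {\<omega> \<in> space M. \<forall>k\<in>{s..<t}. incr k t \<omega> \<noteq> 0} =
      {\<omega> \<in> space M. (\<forall>k\<in>{r..<i}. incr k i \<omega> \<noteq> 0) \<and> (\<forall>k\<in>{s..<t}. incr k t \<omega> \<noteq> 0)}" by blast
  ultimately show ?thesis by simp
qed

text \<open>
  The window \<open>h\<close> has to be short for the first summability condition, which makes coins in the
  window rare, and long for the second one, which makes returns to the distant past rare.
\<close>

lemma range_density_lower_bound:
  fixes h :: "nat \<Rightarrow> nat"
  assumes h: "\<And>t. 1 \<le> t \<Longrightarrow> 1 \<le> h t" "\<And>t. 1 \<le> t \<Longrightarrow> (h t)\<^sup>2 \<le> t"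
    and coins: "summable (\<lambda>t. (\<Sum>i\<in>{t - h t<..t}. p i) / real t)"
    and heat: "summable (\<lambda>t. real (h t) powr (- real CARD('d) / 2))"
  shows "AE \<omega> in M. \<forall>e>0. \<forall>\<^sub>F n in sequentially.
    no_return_prob M \<xi> - e \<le> real (card (walk_range X n \<omega>)) / real n"
proof -
  have h_le: "h t \<le> t" if "1 \<le> t" for t
    using h(2)[OF that] by (rule power2_nat_le_imp_le)
  obtain c where c: "0 \<le> c" "\<And>s n z. 1 \<le> n \<Longrightarrow>
      \<P>(\<omega> in M. incr s (s + n) \<omega> = z) \<le> c * real n powr (- real CARD('d) / 2)"
    using heat_kernel_bound by blast
  define s where "s t = t - h t" for t
  define coin where "coin t = {\<omega> \<in> space M. \<exists>i\<in>{s t<..t}. U i \<omega> \<le> p i}" for t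
  define hit where "hit t = {\<omega> \<in> space M. \<exists>k\<le>s t. X k \<omega> - X (s t) \<omega> = incr (s t) t \<omega>}" for t
  define G where "G t = {\<omega> \<in> space M. \<forall>k\<in>{s t..<t}. incr k t \<omega> \<noteq> 0}" for t
  have coin: "coin t \<in> events" "prob (coin t) \<le> (\<Sum>i\<in>{t - h t<..t}. p i)" for t
    unfolding coin_def s_def by (fact coin_window_prob)+
  have hit: "hit t \<in> events" "prob (hit t) \<le> (real (s t) + 1) * (c * real (h t) powr (- real CARD('d) / 2))"
    if "1 \<le> t" for t
  proof -
    have "s t \<le> t" "s t + h t = t" using h_le[OF that] by (auto simp: s_def)
    with c(2)[OF h(1)[OF that], of "s t"]
    have "\<And>z. \<P>(\<omega> in M. incr (s t) t \<omega> = z) \<le> c * real (h t) powr (- real CARD('d) / 2)" by simp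
    note bound = hit_past_prob[OF \<open>s t \<le> t\<close> this]
    show "hit t \<in> events" unfolding hit_def by (rule bound(1))
    show "prob (hit t) \<le> (real (s t) + 1) * (c * real (h t) powr (- real CARD('d) / 2))"
      unfolding hit_def by (rule bound(2))
  qed
  define B where "B t = (if t = 0 then {} else coin t \<union> hit t)" for t
  have B: "B t \<in> events" for t
    using coin(1)[of t] hit(1)[of t] by (auto simp: B_def)
  have "summable (\<lambda>t. prob (B t) / real t)"
  proof (rule summable_comparison_test'[where N = 1])
    show "summable (\<lambda>t. (\<Sum>i\<in>{t - h t<..t}. p i) / real t + c * real (h t) powr (- real CARD('d) / 2))"
      by (intro summable_add coins summable_mult heat)
    fix t :: nat assume t: "1 \<le> t"
    have "prob (B t) \<le> prob (coin t) + prob (hit t)"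
      using t coin(1) hit(1)[OF t] by (auto simp: B_def intro: measure_Un_le)
    also have "\<dots> \<le> (\<Sum>i\<in>{t - h t<..t}. p i) + (real (s t) + 1) * (c * real (h t) powr (- real CARD('d) / 2))"
      by (intro add_mono coin(2) hit(2)[OF t])
    also have "\<dots> \<le> (\<Sum>i\<in>{t - h t<..t}. p i) + real t * (c * real (h t) powr (- real CARD('d) / 2))"
    proof -
      have "s t + 1 \<le> t" using h(1)[OF t] h_le[OF t] by (simp add: s_def)
      then have "real (s t) + 1 \<le> real t" by linarith
      then show ?thesis using c(1) by (intro add_left_mono mult_right_mono) auto
    qed
    finally have "prob (B t) / real t \<le>
        ((\<Sum>i\<in>{t - h t<..t}. p i) + real t * (c * real (h t) powr (- real CARD('d) / 2))) / real t"
      by (intro divide_right_mono) auto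
    also have "\<dots> = (\<Sum>i\<in>{t - h t<..t}. p i) / real t + c * real (h t) powr (- real CARD('d) / 2)"
      using t by (simp add: add_divide_distrib)
    finally show "norm (prob (B t) / real t) \<le>
        (\<Sum>i\<in>{t - h t<..t}. p i) / real t + c * real (h t) powr (- real CARD('d) / 2)" by simp
  qed
  with B have bad: "AE \<omega> in M. (\<lambda>n. real (card {t \<in> {1..n}. \<omega> \<in> B t}) / real n) \<longlonglongrightarrow> 0"
    by (rule AE_density_zero)
  have good: "AE \<omega> in M. \<forall>e>0. \<forall>\<^sub>F n in sequentially.
      no_return_prob M \<xi> - e \<le> real (card {t \<in> {1..n}. \<omega> \<in> G t}) / real n"
  proof (rule AE_density_local_dependence)
    show "G t \<in> events" for t unfolding G_def by (rule recent_event)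
    show "prob (G i \<inter> G j) = prob (G i) * prob (G j)" if "1 \<le> i" "i + h j \<le> j" for i j
      unfolding G_def using that by (intro recent_indep) (simp add: s_def)
    show "(h t)\<^sup>2 \<le> t" if "1 \<le> t" for t using h(2)[OF that] .
    show "no_return_prob M \<xi> \<le> prob (G t)" if "1 \<le> t" for t
      unfolding G_def using h(1)[OF that] that by (intro no_return_window_prob) (simp add: s_def)
  qed
  show ?thesis
    using bad good AE_space
  proof eventually_elim
    fix \<omega>
    assume bad: "(\<lambda>n. real (card {t \<in> {1..n}. \<omega> \<in> B t}) / real n) \<longlonglongrightarrow> 0"
      and good: "\<forall>e>0. \<forall>\<^sub>F n in sequentially. no_return_prob M \<xi> - e \<le> real (card {t \<in> {1..n}. \<omega> \<in> G t}) / real n"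
      and \<omega>: "\<omega> \<in> space M"
    show "\<forall>e>0. \<forall>\<^sub>F n in sequentially. no_return_prob M \<xi> - e \<le> real (card (walk_range X n \<omega>)) / real n"
    proof (intro allI impI)
      fix e :: real assume "0 < e"
      then have "\<forall>\<^sub>F n in sequentially. real (card {t \<in> {1..n}. \<omega> \<in> B t}) / real n < e / 2"
        by (intro order_tendstoD(2)[OF bad]) auto
      moreover from \<open>0 < e\<close> good have
        "\<forall>\<^sub>F n in sequentially. no_return_prob M \<xi> - e / 2 \<le> real (card {t \<in> {1..n}. \<omega> \<in> G t}) / real n"
        by simp
      ultimately show "\<forall>\<^sub>F n in sequentially. no_return_prob M \<xi> - e \<le> real (card (walk_range X n \<omega>)) / real n"
      proof eventually_elim
        case (elim n)
        have "{t \<in> {1..n}. \<omega> \<in> G t} \<subseteq> {t \<in> {1..n}. \<omega> \<notin> revisit X t} \<union> {t \<in> {1..n}. \<omega> \<in> B t}"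
        proof safe
          fix t assume t: "t \<in> {1..n}" "\<omega> \<in> G t" "\<omega> \<notin> B t"
          then have "\<omega> \<notin> coin t" "\<omega> \<notin> hit t" by (auto simp: B_def)
          have "p i < U i \<omega>" if "i \<in> {s t<..t}" for i
            using \<open>\<omega> \<notin> coin t\<close> \<omega> that by (auto simp: coin_def not_le)
          moreover have "X k \<omega> - X (s t) \<omega> \<noteq> incr (s t) t \<omega>" if "k \<le> s t" for k
            using \<open>\<omega> \<notin> hit t\<close> \<omega> that by (auto simp: hit_def)
          moreover have "s t \<le> t" by (simp add: s_def)
          moreover have "incr k t \<omega> \<noteq> 0" if "k \<in> {s t..<t}" for k
            using t(2) that by (auto simp: G_def)
          ultimately have "\<omega> \<notin> revisit X t" by (intro new_site_if[OF \<omega>])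
          moreover assume "\<omega> \<in> revisit X t"
          ultimately show False by contradiction
        qed
        then have "card {t \<in> {1..n}. \<omega> \<in> G t} \<le>
            card ({t \<in> {1..n}. \<omega> \<notin> revisit X t} \<union> {t \<in> {1..n}. \<omega> \<in> B t})"
          by (intro card_mono) auto
        also have "\<dots> \<le> card {t \<in> {1..n}. \<omega> \<notin> revisit X t} + card {t \<in> {1..n}. \<omega> \<in> B t}"
          by (rule card_Un_le)
        also have "\<dots> \<le> card (walk_range X n \<omega>) + card {t \<in> {1..n}. \<omega> \<in> B t}"
          by (intro add_right_mono card_new_sites_le_range)
        finally have "real (card {t \<in> {1..n}. \<omega> \<in> G t}) \<le> real (card (walk_range X n \<omega>)) + real (card {t \<in> {1..n}. \<omega> \<in> B t})"
          by linarith
        then have "real (card {t \<in> {1..n}. \<omega> \<in> G t}) / real n \<le>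
            real (card (walk_range X n \<omega>)) / real n + real (card {t \<in> {1..n}. \<omega> \<in> B t}) / real n"
          by (simp only: add_divide_distrib[symmetric]) (intro divide_right_mono; simp)
        with elim show ?case by linarith
      qed
    qed
  qed
qed

end

section \<open>The choice of the window\<close>

lemma floor_powr_window:
  fixes \<beta> :: real and t :: nat
  assumes "0 < \<beta>" "\<beta> \<le> 1" "1 \<le> t"
  defines "h \<equiv> nat \<lfloor>real t powr (\<beta> / 2)\<rfloor>"
  shows "1 \<le> h" "h\<^sup>2 \<le> t" "real h \<le> real t powr (\<beta> / 2)" "real t powr (\<beta> / 2) / 2 \<le> real h"
proof -
  let ?x = "real t powr (\<beta> / 2)"
  have x: "1 \<le> ?x" using assms by (intro ge_one_powr_ge_zero) auto
  show "1 \<le> h" using x unfolding h_def by (simp add: le_nat_iff le_floor_iff)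
  show le: "real h \<le> ?x" using x unfolding h_def by simp
  show "?x / 2 \<le> real h"
    using x \<open>1 \<le> h\<close> unfolding h_def by linarith
  have "real (h\<^sup>2) \<le> ?x\<^sup>2" using le by (simp add: power_mono)
  also have "?x\<^sup>2 = real t powr \<beta>"
    using assms by (simp add: powr_powr flip: powr_numeral)
  also have "\<dots> \<le> real t powr 1" using assms by (intro powr_mono) auto
  also have "real t powr 1 = real t" using assms by simp
  finally show "h\<^sup>2 \<le> t" by (simp only: of_nat_le_iff)
qed

theorem proposition2p2:
  fixes M :: "'a measure" and F :: "nat \<Rightarrow> 'a measure"
    and \<xi> \<gamma> X :: "nat \<Rightarrow> 'a \<Rightarrow> int ^ 'd" and U :: "nat \<Rightarrow> 'a \<Rightarrow> real"
    and l :: "real ^ 'd" and C \<beta> :: real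
  assumes "C > 0" and "0 < \<beta>" and "\<beta> \<le> 1"
    and "CARD('d) \<ge> 3"
    and "int CARD('d) \<ge> max 9 (\<lfloor>2 + 4 / \<beta>\<rfloor> + 1)"
    and "pn_ERW M F \<xi> \<gamma> U (\<lambda>n. min (C * real n powr (- \<beta>)) 1) l X"
  shows "AE \<omega> in M. liminf (\<lambda>n. ereal (real (card (walk_range X n \<omega>)) / real n))
           \<ge> ereal (no_return_prob M \<xi>)"
proof -
  interpret pn_ERW M F \<xi> \<gamma> U "\<lambda>n. min (C * real n powr (- \<beta>)) 1" l X by fact
  let ?p = "\<lambda>n. min (C * real n powr (- \<beta>)) 1"
  define h where "h t = nat \<lfloor>real t powr (\<beta> / 2)\<rfloor>" for t
  have h: "1 \<le> h t" "(h t)\<^sup>2 \<le> t" "real (h t) \<le> real t powr (\<beta> / 2)" "real t powr (\<beta> / 2) / 2 \<le> real (h t)"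
    if "1 \<le> t" for t
    unfolding h_def by (intro floor_powr_window assms that)+
  \<comment> \<open>\<open>\<lfloor>x\<rfloor> + 1\<close> exceeds \<open>x\<close>.\<close>
  have "4 / \<beta> < real CARD('d)"
    using assms(5) by linarith
  then have d: "4 < \<beta> * real CARD('d)"
    using \<open>0 < \<beta>\<close> by (simp add: pos_divide_less_eq mult.commute)
  have "AE \<omega> in M. \<forall>e>0. \<forall>\<^sub>F n in sequentially.
    no_return_prob M \<xi> - e \<le> real (card (walk_range X n \<omega>)) / real n"
  proof (rule range_density_lower_bound[of h])
    show "summable (\<lambda>t. (\<Sum>i\<in>{t - h t<..t}. ?p i) / real t)"
    proof (rule summable_comparison_test'[where N = 4])
      show "summable (\<lambda>t. 2 * C * real t powr (- \<beta> / 2 - 1))"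
        using \<open>0 < \<beta>\<close> by (intro summable_mult) (simp add: summable_real_powr_iff)
      fix t :: nat assume t: "4 \<le> t"
      \<comment> \<open>From \<open>(h t)\<^sup>2 \<le> t\<close> and \<open>4 \<le> t\<close>, the window lies in the second half of \<open>{..t}\<close>.\<close>
      have half: "real t / 2 \<le> real i" if "i \<in> {t - h t<..t}" for i
      proof -
        have "(2 * h t)\<^sup>2 \<le> t\<^sup>2"
        proof -
          have "(2 * h t)\<^sup>2 = 4 * (h t)\<^sup>2" by (simp add: power_mult_distrib)
          also have "\<dots> \<le> t * t" using h(2)[of t] t by (intro mult_mono) auto
          finally show ?thesis by (simp add: power2_eq_square)
        qed
        then have "2 * h t \<le> t" by (rule power2_le_imp_le) simp
        with that show ?thesis by auto
      qed
      have p: "?p i \<le> 2 * C * real t powr (- \<beta>)" if "i \<in> {t - h t<..t}" for i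
      proof -
        have "?p i \<le> C * real i powr (- \<beta>)" by simp
        also have "\<dots> \<le> C * (real t / 2) powr (- \<beta>)"
          using half[OF that] t assms(1,2) by (intro mult_left_mono powr_mono2') auto
        also have "(real t / 2) powr (- \<beta>) = real t powr (- \<beta>) * 2 powr \<beta>"
          by (simp add: powr_divide powr_minus_divide)
        also have "C * \<dots> \<le> C * (real t powr (- \<beta>) * 2 powr 1)"
          using assms(1,3) by (intro mult_left_mono powr_mono) auto
        finally show ?thesis by (simp add: mult_ac)
      qed
      have "(\<Sum>i\<in>{t - h t<..t}. ?p i) \<le> (\<Sum>i\<in>{t - h t<..t}. 2 * C * real t powr (- \<beta>))"
        by (intro sum_mono p)
      also have "\<dots> \<le> real (h t) * (2 * C * real t powr (- \<beta>))"
        using assms(1) by (simp add: mult_right_mono)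
      also have "\<dots> \<le> real t powr (\<beta> / 2) * (2 * C * real t powr (- \<beta>))"
        using assms(1) t by (intro mult_right_mono h(3)) auto
      also have "\<dots> = 2 * C * real t powr (- \<beta> / 2)"
        by (simp add: powr_add[symmetric] field_simps)
      finally have "(\<Sum>i\<in>{t - h t<..t}. ?p i) / real t \<le> 2 * C * real t powr (- \<beta> / 2) / real t"
        by (intro divide_right_mono) auto
      also have "\<dots> = 2 * C * real t powr (- \<beta> / 2 - 1)"
        using t by (simp add: powr_diff)
      finally show "norm ((\<Sum>i\<in>{t - h t<..t}. ?p i) / real t) \<le> 2 * C * real t powr (- \<beta> / 2 - 1)"
        using assms(1) by (simp add: sum_nonneg)
    qed
    show "summable (\<lambda>t. real (h t) powr (- real CARD('d) / 2))"
    proof (rule summable_comparison_test'[where N = 1])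
      show "summable (\<lambda>t. (1 / 2) powr (- real CARD('d) / 2) * real t powr (- (\<beta> * real CARD('d) / 4)))"
        using d by (intro summable_mult) (simp add: summable_real_powr_iff)
      fix t :: nat assume t: "1 \<le> t"
      have "real (h t) powr (- real CARD('d) / 2) \<le> (1 / 2 * real t powr (\<beta> / 2)) powr (- real CARD('d) / 2)"
        using h(4)[OF t] t by (intro powr_mono2') auto
      also have "\<dots> = (1 / 2) powr (- real CARD('d) / 2) * real t powr (- (\<beta> * real CARD('d) / 4))"
        by (subst powr_mult) (simp_all add: powr_powr)
      finally show "norm (real (h t) powr (- real CARD('d) / 2)) \<le>
          (1 / 2) powr (- real CARD('d) / 2) * real t powr (- (\<beta> * real CARD('d) / 4))" by simp
    qed
  qed (use h in auto)
  then show ?thesis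
  proof eventually_elim
    fix \<omega>
    assume *: "\<forall>e>0. \<forall>\<^sub>F n in sequentially.
      no_return_prob M \<xi> - e \<le> real (card (walk_range X n \<omega>)) / real n"
    show "liminf (\<lambda>n. ereal (real (card (walk_range X n \<omega>)) / real n)) \<ge> ereal (no_return_prob M \<xi>)"
      unfolding le_Liminf_iff
    proof (intro allI impI)
      fix y assume "y < ereal (no_return_prob M \<xi>)"
      then obtain r where r: "y < ereal r" "r < no_return_prob M \<xi>"
        using ereal_dense2 by force
      have "\<forall>\<^sub>F n in sequentially. no_return_prob M \<xi> - (no_return_prob M \<xi> - r)
          \<le> real (card (walk_range X n \<omega>)) / real n"
        by (rule *[rule_format]) (use r in simp)
      then show "\<forall>\<^sub>F n in sequentially. y < ereal (real (card (walk_range X n \<omega>)) / real n)"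
        by eventually_elim (use r(1) less_le_trans in force)
    qed
  qed
qed

end
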